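(* Let $\tau$ be a primitive aperiodic substitution on a finite alphabet $A$. Then $\tau$, regarded as a dill map $\tau : X_\tau \to X_\tau$ on its one-sided subshift, is almost invertible. If moreover $\tau$ has balanced growth, then it has an almost inverse with balanced growth.
   Context: $\mathbb{N}$ contains $0$. For a finite alphabet $A$, $A^*$ is the set of finite words, and $v \sqsubset w$ means that $v$ is a factor of $w$. The shift on $A^{\mathbb{N}}$ is $\sigma(x)_i = x_{i+1}$; a subshift is a closed $X \subset A^{\mathbb{N}}$ with $\sigma(X) \subset X$. Substitutions. A substitution on $A$ is a map $\tau : A^* \to A^*$ with $\tau(uv) = \tau(u)\tau(v)$. Its one-sided subshift $X_\tau \subset A^{\mathbb{N}}$ is the set of $x \in A^{\mathbb{N}}$ all of whose factors are factors of $\tau^n(a)$ for some $a \in A$, $n \in \mathbb{N}$; $\tau$ acts on it by $\tau(x) = \tau(x_0)\tau(x_1)\cdots$. $\tau$ is primitive if for all $a,b \in A$, $a \sqsubset \tau^n(b)$ for all large enough $n$, and aperiodic if $X_\tau$ contains no $\sigma$-periodic point. Dill maps. A dill map between subshifts $X, Y \subset A^{\mathbb{N}}$ is a continuous map $\Phi : X \to Y$ for which there is a continuous $s : X \to \mathbb{N}$ with $\Phi(\sigma(x)) = \sigma^{s(x)}(\Phi(x))$ for all $x \in X$, and such that for all $x \in X$ there is $n \in \mathbb{N}$ with $s(\sigma^n(x)) > 0$. For a primitive aperiodic substitution $\tau$, the action $\tau : X_\tau \to X_\tau$, $\tau(x) = \tau(x_0)\tau(x_1)\cdots$, is a dill map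 with $s(x) = |\tau(x_0)|$. An implementation of $\Phi$ is a continuous map $\phi : X \to A^*$ ($A^*$ discrete) with $\Phi(x) = \phi(x)\phi(\sigma(x))\phi(\sigma^2(x))\cdots$ for all $x \in X$; when $Y$ contains no $\sigma$-periodic points it exists and is unique. Write ${}^n\phi(x) = \phi(x)\phi(\sigma(x))\cdots\phi(\sigma^{n-1}(x))$. Balanced growth. A dill map $\Phi : X \to Y$, with $Y$ containing no $\sigma$-periodic points, and with implementation $\phi$, has balanced growth if there is $Z \in \mathbb{R}$ with $\lim_n |{}^n\phi(x)|/n = Z$ for all $x \in X$, and there is $D \in \mathbb{N}$ with $|{}^n\phi(x)| \in [Zn - D, Zn + D]$ for all $x \in X$, $n \in \mathbb{N}$. Almost invertibility. For dill maps $\Phi, \Psi : X \to Y$ with $X$ uniformly recurrent (minimal), $\Phi \sim \Psi$ (almost equivalent) means: for all $x \in X$ there are $i, j \in \mathbb{N}$ with $\sigma^i(\Phi(x)) = \sigma^j(\Psi(x))$. An almost inverse of a dill map $\Phi_1 : X \to Y$ is a dill map $\Phi_2 : Y \to X$ with $\Phi_2 \circ \Phi_1 \sim \mathrm{id}_X$ and $\Phi_1 \circ \Phi_2 \sim \mathrm{id}_Y$; $\Phi_1$ is almost invertible if it has an almost inverse. *)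

theory Defs
  imports "HOL-Analysis.Analysis" "HOL-Library.Sublist"
begin

text \<open>The alphabet is the type \<open>'a\<close> of class \<open>finite\<close>. Finite words are lists,
  one-sided infinite words are functions on \<open>nat\<close>, and \<^const>\<open>sublist\<close> is the
  (contiguous) factor relation.\<close>

definition full_shift :: "(nat \<Rightarrow> 'a) topology" where
  "full_shift = product_topology (\<lambda>_. discrete_topology UNIV) UNIV"

definition shift :: "(nat \<Rightarrow> 'a) \<Rightarrow> (nat \<Rightarrow> 'a)" where
  "shift x = (\<lambda>i. x (i + 1))"

definition subshift :: "(nat \<Rightarrow> 'a) set \<Rightarrow> bool" where
  "subshift X \<longleftrightarrow> closedin full_shift X \<and> shift ` X \<subseteq> X"

definition minimal_subshift :: "(nat \<Rightarrow> 'a) set \<Rightarrow> bool" where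
  "minimal_subshift X \<longleftrightarrow> subshift X \<and> (\<forall>Y. subshift Y \<and> Y \<subseteq> X \<longrightarrow> Y = {} \<or> Y = X)"

definition periodic_point :: "(nat \<Rightarrow> 'a) \<Rightarrow> bool" where
  "periodic_point x \<longleftrightarrow> (\<exists>p>0. (shift ^^ p) x = x)"

definition no_periodic_points :: "(nat \<Rightarrow> 'a) set \<Rightarrow> bool" where
  "no_periodic_points X \<longleftrightarrow> (\<forall>x\<in>X. \<not> periodic_point x)"

definition factors :: "(nat \<Rightarrow> 'a) \<Rightarrow> 'a list set" where
  "factors x = {map x [i..<j] | i j. True}"

definition concat_upto :: "(nat \<Rightarrow> 'a list) \<Rightarrow> nat \<Rightarrow> 'a list" where
  "concat_upto w n = concat (map w [0..<n])"

text \<open>\<open>has_inf_concat w x\<close> means \<open>x = w 0 @ w 1 @ w 2 @ \<dots>\<close>. Divergence of the lengths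
  is required because some of the words (even infinitely many) may be empty.\<close>

definition has_inf_concat :: "(nat \<Rightarrow> 'a list) \<Rightarrow> (nat \<Rightarrow> 'a) \<Rightarrow> bool" where
  "has_inf_concat w x \<longleftrightarrow>
     (\<forall>n. concat_upto w n = map x [0..<length (concat_upto w n)]) \<and>
     filterlim (\<lambda>n. length (concat_upto w n)) at_top sequentially"

definition inf_concat :: "(nat \<Rightarrow> 'a list) \<Rightarrow> (nat \<Rightarrow> 'a)" where
  "inf_concat w = (THE x. has_inf_concat w x)"

lemma has_inf_concat_nth:
  assumes "has_inf_concat w x" "i < length (concat_upto w n)"
  shows "concat_upto w n ! i = x i"
proof -
  have "concat_upto w n ! i = map x [0..<length (concat_upto w n)] ! i"
    using assms(1) unfolding has_inf_concat_def by metis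
  then show ?thesis using assms(2) by simp
qed

lemma has_inf_concat_unique:
  assumes "has_inf_concat w x" "has_inf_concat w y"
  shows "x = y"
proof
  fix i
  have "\<forall>\<^sub>F n in sequentially. Suc i \<le> length (concat_upto w n)"
    using assms(1) unfolding has_inf_concat_def filterlim_at_top by blast
  then obtain n where "i < length (concat_upto w n)"
    by (metis Suc_le_lessD eventually_sequentially order_refl)
  then show "x i = y i"
    using has_inf_concat_nth assms by metis
qed

lemma inf_concat_eqI: "has_inf_concat w x \<Longrightarrow> inf_concat w = x"
  unfolding inf_concat_def using has_inf_concat_unique by blast

lemma concat_upto_prefix:
  assumes "m \<le> n"
  shows "prefix (concat_upto w m) (concat_upto w n)"
proof -
  have "[0..<n] = [0..<m] @ [m..<n]"
    using assms upt_add_eq_append[of 0 m "n - m"] by simp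
  then show ?thesis by (simp add: concat_upto_def)
qed

lemma has_inf_concat_inf_concat:
  assumes lim: "filterlim (\<lambda>n. length (concat_upto w n)) at_top sequentially"
  shows "has_inf_concat w (inf_concat w)"
proof -
  have "\<exists>n. i < length (concat_upto w n)" for i
  proof -
    have "\<forall>\<^sub>F n in sequentially. Suc i \<le> length (concat_upto w n)"
      using lim unfolding filterlim_at_top by blast
    then show ?thesis by (metis Suc_le_lessD eventually_sequentially order_refl)
  qed
  then obtain N where N: "\<And>i. i < length (concat_upto w (N i))" by metis
  define x where "x i = concat_upto w (N i) ! i" for i
  have *: "concat_upto w n ! i = x i" if "i < length (concat_upto w n)" for n i
  proof (cases "n \<le> N i")
    case True
    then show ?thesis
      using concat_upto_prefix[of n "N i" w] that
      by (auto simp: x_def prefix_def nth_append)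
  next
    case False
    then show ?thesis
      using concat_upto_prefix[of "N i" n w] N[of i]
      by (auto simp: x_def prefix_def nth_append)
  qed
  have "has_inf_concat w x"
    unfolding has_inf_concat_def using lim * by (auto intro!: nth_equalityI)
  then show ?thesis using inf_concat_eqI by metis
qed

definition substitution :: "('a list \<Rightarrow> 'a list) \<Rightarrow> bool" where
  "substitution \<tau> \<longleftrightarrow> (\<forall>u v. \<tau> (u @ v) = \<tau> u @ \<tau> v)"

definition subst_subshift :: "('a list \<Rightarrow> 'a list) \<Rightarrow> (nat \<Rightarrow> 'a) set" where
  "subst_subshift \<tau> = {x. \<forall>u\<in>factors x. \<exists>a n. sublist u ((\<tau> ^^ n) [a])}"

definition subst_action :: "('a list \<Rightarrow> 'a list) \<Rightarrow> (nat \<Rightarrow> 'a) \<Rightarrow> (nat \<Rightarrow> 'a)" where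
  "subst_action \<tau> x = inf_concat (\<lambda>i. \<tau> [x i])"

definition primitive_subst :: "('a list \<Rightarrow> 'a list) \<Rightarrow> bool" where
  "primitive_subst \<tau> \<longleftrightarrow> (\<forall>a b. \<forall>\<^sub>F n in sequentially. sublist [a] ((\<tau> ^^ n) [b]))"

definition aperiodic_subst :: "('a list \<Rightarrow> 'a list) \<Rightarrow> bool" where
  "aperiodic_subst \<tau> \<longleftrightarrow> no_periodic_points (subst_subshift \<tau>)"

definition dill_map ::
    "(nat \<Rightarrow> 'a) set \<Rightarrow> (nat \<Rightarrow> 'a) set \<Rightarrow> ((nat \<Rightarrow> 'a) \<Rightarrow> (nat \<Rightarrow> 'a)) \<Rightarrow> bool" where
  "dill_map X Y \<Phi> \<longleftrightarrow>
     subshift X \<and> subshift Y \<and>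
     continuous_map (subtopology full_shift X) (subtopology full_shift Y) \<Phi> \<and>
     (\<exists>s :: (nat \<Rightarrow> 'a) \<Rightarrow> nat.
        continuous_map (subtopology full_shift X) (discrete_topology UNIV) s \<and>
        (\<forall>x\<in>X. \<Phi> (shift x) = (shift ^^ s x) (\<Phi> x)) \<and>
        (\<forall>x\<in>X. \<exists>n. s ((shift ^^ n) x) > 0))"

definition implementation ::
    "(nat \<Rightarrow> 'a) set \<Rightarrow> ((nat \<Rightarrow> 'a) \<Rightarrow> (nat \<Rightarrow> 'a)) \<Rightarrow> ((nat \<Rightarrow> 'a) \<Rightarrow> 'a list) \<Rightarrow> bool" where
  "implementation X \<Phi> \<phi> \<longleftrightarrow>
     continuous_map (subtopology full_shift X) (discrete_topology UNIV) \<phi> \<and>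
     (\<forall>x\<in>X. has_inf_concat (\<lambda>i. \<phi> ((shift ^^ i) x)) (\<Phi> x))"

definition iter_word :: "((nat \<Rightarrow> 'a) \<Rightarrow> 'a list) \<Rightarrow> nat \<Rightarrow> (nat \<Rightarrow> 'a) \<Rightarrow> 'a list" where
  "iter_word \<phi> n x = concat_upto (\<lambda>i. \<phi> ((shift ^^ i) x)) n"

text \<open>Since \<open>Y\<close> has no periodic points, the implementation is unique on \<open>X\<close>, so
  quantifying it existentially amounts to speaking of \<open>the\<close> implementation.\<close>

definition balanced_growth ::
    "(nat \<Rightarrow> 'a) set \<Rightarrow> (nat \<Rightarrow> 'a) set \<Rightarrow> ((nat \<Rightarrow> 'a) \<Rightarrow> (nat \<Rightarrow> 'a)) \<Rightarrow> bool" where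
  "balanced_growth X Y \<Phi> \<longleftrightarrow>
     dill_map X Y \<Phi> \<and> no_periodic_points Y \<and>
     (\<exists>\<phi>. implementation X \<Phi> \<phi> \<and>
        (\<exists>Z::real.
           (\<forall>x\<in>X. (\<lambda>n. real (length (iter_word \<phi> n x)) / real n) \<longlonglongrightarrow> Z) \<and>
           (\<exists>D::nat. \<forall>x\<in>X. \<forall>n.
              real (length (iter_word \<phi> n x)) \<in> {Z * real n - real D .. Z * real n + real D})))"

definition almost_equivalent ::
    "(nat \<Rightarrow> 'a) set \<Rightarrow> (nat \<Rightarrow> 'a) set \<Rightarrow>
     ((nat \<Rightarrow> 'a) \<Rightarrow> (nat \<Rightarrow> 'a)) \<Rightarrow> ((nat \<Rightarrow> 'a) \<Rightarrow> (nat \<Rightarrow> 'a)) \<Rightarrow> bool" where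
  "almost_equivalent X Y \<Phi> \<Psi> \<longleftrightarrow>
     minimal_subshift X \<and> dill_map X Y \<Phi> \<and> dill_map X Y \<Psi> \<and>
     (\<forall>x\<in>X. \<exists>i j. (shift ^^ i) (\<Phi> x) = (shift ^^ j) (\<Psi> x))"

definition almost_inverse ::
    "(nat \<Rightarrow> 'a) set \<Rightarrow> (nat \<Rightarrow> 'a) set \<Rightarrow>
     ((nat \<Rightarrow> 'a) \<Rightarrow> (nat \<Rightarrow> 'a)) \<Rightarrow> ((nat \<Rightarrow> 'a) \<Rightarrow> (nat \<Rightarrow> 'a)) \<Rightarrow> bool" where
  "almost_inverse X Y \<Phi>\<^sub>1 \<Phi>\<^sub>2 \<longleftrightarrow>
     dill_map X Y \<Phi>\<^sub>1 \<and> dill_map Y X \<Phi>\<^sub>2 \<and>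
     almost_equivalent X X (\<Phi>\<^sub>2 \<circ> \<Phi>\<^sub>1) id \<and>
     almost_equivalent Y Y (\<Phi>\<^sub>1 \<circ> \<Phi>\<^sub>2) id"

definition almost_invertible ::
    "(nat \<Rightarrow> 'a) set \<Rightarrow> (nat \<Rightarrow> 'a) set \<Rightarrow> ((nat \<Rightarrow> 'a) \<Rightarrow> (nat \<Rightarrow> 'a)) \<Rightarrow> bool" where
  "almost_invertible X Y \<Phi> \<longleftrightarrow> (\<exists>\<Psi>. almost_inverse X Y \<Phi> \<Psi>)"

end

theory Submission
  imports Defs
begin

text \<open>An almost inverse has to recover \<open>x\<close> from \<open>\<tau>(x)\<close> up to a shift. Two facts make this possible.
  The kernels of the powers of \<open>\<tau>\<close>, as relations on words, stabilize, by a defect argument; so for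
  some \<open>p\<close> the word \<open>\<tau>\<^sup>p v\<close> is determined by \<open>\<tau>\<^sup>p\<^sup>+\<^sup>1 v\<close>. And for \<open>T = \<tau>\<^sup>p\<^sup>+\<^sup>1\<close> there is a synchronizing
  word, all of whose occurrences in images under \<open>T\<close> have a cutting point at the same place:
  otherwise every long word of the language would have two minimal covers by images under \<open>T\<close>, hence
  at least \<open>2\<^sup>n\<close> minimal covers by images under \<open>T\<^sup>n\<close>, whereas words of length comparable to
  \<open>\<bar>T\<^sup>n\<bar>\<close> have boundedly many of these, because the language contains no high powers. The almost
  inverse replaces each block \<open>T v\<close> between two consecutive synchronized cutting points by
  \<open>\<tau>\<^sup>p v\<close>. This is weaker than Mosse's recognizability theorem, and \<open>\<tau>\<close> may identify letters.\<close>

section \<open>Stabilization of kernels\<close>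

text \<open>The obstacle is that \<open>\<tau>\<close> may identify letters: even if every cutting
  point of \<open>\<tau>(x)\<close> were known, the letters of \<open>x\<close> could be lost. The
  remedy is that each segment of \<open>x\<close> between synchronized cuts is itself of the form
  \<open>(\<tau> ^^ p) v\<close>, and on words of this form \<open>\<tau>\<close> is injective. This
  is why cuts are taken with respect to \<open>\<tau> ^^ Suc p\<close> instead of
  \<open>\<tau>\<close>. One synchronizing word is enough: by linear recurrence it returns with gaps
  bounded uniformly over the subshift, and almost equivalence permits forgetting what precedes the
  first cut. The same gap bound gives balanced growth: applying \<open>\<tau>\<close> to the output
  restores the input between two cuts, so if \<open>n\<close> input letters yield \<open>l\<close>
  output letters and \<open>\<tau>\<close> grows at rate \<open>Z\<close>, then \<open>Z l\<close>
  stays within a bounded distance of \<open>n\<close>, and the inverse grows at rate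
  \<open>1 / Z\<close>.\<close>

lemma substitution_Nil: "substitution f \<Longrightarrow> f [] = []"
  unfolding substitution_def by (metis append_self_conv)

lemma substitution_append: "substitution f \<Longrightarrow> f (u @ v) = f u @ f v"
  unfolding substitution_def by blast

lemma substitution_Cons: "substitution f \<Longrightarrow> f (a # u) = f [a] @ f u"
  using substitution_append[of f "[a]" u] by simp

lemma substitution_eq_concat: "substitution f \<Longrightarrow> f u = concat (map (\<lambda>a. f [a]) u)"
proof (induction u)
  case Nil then show ?case by (simp add: substitution_Nil)
next
  case (Cons a u) then show ?case using substitution_Cons[of f a u] by simp
qed

lemma substitution_concat_map: "substitution (\<lambda>u. concat (map g u))"
  by (simp add: substitution_def)

lemma append_eq_append_le:
  "a @ b = c @ d \<Longrightarrow> length a \<le> length c \<Longrightarrow> \<exists>t. c = a @ t \<and> b = t @ d"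
  by (auto simp: append_eq_append_conv2)

lemma substitution_comp: "substitution f \<Longrightarrow> substitution g \<Longrightarrow> substitution (\<lambda>u. f (g u))"
  by (simp add: substitution_def)

lemma substitution_funpow: "substitution f \<Longrightarrow> substitution (f ^^ n)"
  by (induction n) (auto simp: substitution_def)

lemma substitution_eqI:
  assumes "substitution f" "substitution g" "\<And>a. a \<in> set u \<Longrightarrow> f [a] = g [a]"
  shows "f u = g u"
proof -
  have "map (\<lambda>a. f [a]) u = map (\<lambda>a. g [a]) u" using assms(3) by simp
  then show ?thesis
    using substitution_eq_concat[OF assms(1), of u] substitution_eq_concat[OF assms(2), of u] by metis
qed

lemma substitution_lists:
  assumes "substitution f" "\<And>a. a \<in> S \<Longrightarrow> f [a] \<in> lists S'" "u \<in> lists S"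
  shows "f u \<in> lists S'"
  using assms(3)
proof (induction u)
  case Nil then show ?case by (simp add: substitution_Nil[OF assms(1)])
next
  case (Cons a u)
  then show ?case using assms(2)[of a] by (subst substitution_Cons[OF assms(1)]) auto
qed

text \<open>Cancel the longest common prefix of \<open>u\<close> and \<open>v\<close>. Neither word
  can be used up before the other, since no letter of \<open>S\<close> is erased, so two different
  letters remain in front.\<close>

lemma differing_letters_if_not_inj:
  assumes f: "substitution f" and ne: "\<And>a. a \<in> S \<Longrightarrow> f [a] \<noteq> []"
    and "u \<in> lists S" "v \<in> lists S" "f u = f v" "u \<noteq> v"
  shows "\<exists>a\<in>S. \<exists>b\<in>S. \<exists>u'\<in>lists S. \<exists>v'\<in>lists S. a \<noteq> b \<and> f (a # u') = f (b # v')"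
  using assms(3-6)
proof (induction u arbitrary: v rule: list.induct)
  case Nil
  then obtain b v' where v: "v = b # v'" "b \<in> S" by (cases v) auto
  then have "f [b] = []"
    using Nil.prems(3) substitution_Cons[OF f, of b v'] substitution_Nil[OF f] by (metis append_is_Nil_conv)
  then show ?case using ne v(2) by blast
next
  case (Cons a u)
  show ?case
  proof (cases v)
    case Nil
    then have "f [a] = []"
      using Cons.prems(3) substitution_Cons[OF f, of a u] substitution_Nil[OF f]
      by (metis append_is_Nil_conv)
    then show ?thesis using ne Cons.prems(1) by auto
  next
    case v: (Cons b v')
    show ?thesis
    proof (cases "a = b")
      case True
      then have "f u = f v'"
        using Cons.prems(3) substitution_Cons[OF f, of a u] substitution_Cons[OF f, of b v'] v
        by (metis same_append_eq)
      then show ?thesis using Cons.IH[of v'] Cons.prems v True by auto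
    next
      case False
      then show ?thesis using Cons.prems v by auto
    qed
  qed
qed

text \<open>A defect theorem. If \<open>f [b] = f [a] @ t\<close>, then \<open>f\<close> factors through \<open>b \<mapsto> [a, b]\<close>,
  followed by the shorter morphism with \<open>b \<mapsto> t\<close>, which is again not injective; the descent stops at
  a morphism that erases a letter.\<close>

lemma non_injective_factorization:
  assumes "finite S" "substitution f" "\<not> inj_on f (lists S)"
  shows "\<exists>b\<in>S. \<exists>\<alpha> \<beta>. substitution \<alpha> \<and> substitution \<beta> \<and>
    (\<forall>a\<in>S. \<beta> [a] \<in> lists (S - {b}) \<and> f [a] = \<alpha> (\<beta> [a])) \<and>
    (\<forall>c\<in>S. set (\<alpha> [c]) \<subseteq> (\<Union>a\<in>S. set (f [a])))"
  using assms(2,3)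
proof (induction "\<Sum>a\<in>S. length (f [a])" arbitrary: f rule: less_induct)
  case less
  note f = less.prems(1)
  show ?case
  proof (cases "\<exists>b\<in>S. f [b] = []")
    case True
    then obtain b where b: "b \<in> S" "f [b] = []" by blast
    define \<beta> where "\<beta> = (\<lambda>u. concat (map (\<lambda>c. if c = b then [] else [c]) u))"
    have "substitution \<beta>" unfolding \<beta>_def by (rule substitution_concat_map)
    moreover have "\<beta> [a] \<in> lists (S - {b}) \<and> f [a] = f (\<beta> [a])" if "a \<in> S" for a
      using that b substitution_Nil[OF f] by (simp add: \<beta>_def)
    ultimately show ?thesis using f b(1) by blast
  next
    case False
    obtain u v where uv: "u \<in> lists S" "v \<in> lists S" "f u = f v" "u \<noteq> v"
      using less.prems(2) by (auto simp: inj_on_def)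
    obtain a b u' v' where ab: "a \<in> S" "b \<in> S" "u' \<in> lists S" "v' \<in> lists S" "a \<noteq> b"
      "f (a # u') = f (b # v')" and le: "length (f [a]) \<le> length (f [b])"
    proof -
      obtain a b u' v' where "a \<in> S" "b \<in> S" "u' \<in> lists S" "v' \<in> lists S" "a \<noteq> b"
        "f (a # u') = f (b # v')"
        using differing_letters_if_not_inj[OF f _ uv] False by blast
      then show ?thesis
        using that[of a b u' v'] that[of b a v' u'] by (metis linorder_le_cases)
    qed
    have "f [a] @ f u' = f [b] @ f v'"
      using ab(6) substitution_Cons[OF f] by metis
    then obtain t where t: "f [b] = f [a] @ t"
      using append_eq_append_le[OF _ le] by blast
    define f' where "f' = (\<lambda>u. concat (map (\<lambda>c. if c = b then t else f [c]) u))"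
    define \<beta>0 where "\<beta>0 = (\<lambda>u. concat (map (\<lambda>c. if c = b then [a, b] else [c]) u))"
    have f': "substitution f'" and \<beta>0: "substitution \<beta>0"
      unfolding f'_def \<beta>0_def by (rule substitution_concat_map)+
    have f\<beta>1: "f [c] = f' (\<beta>0 [c])" for c
      using ab(5) t by (simp add: f'_def \<beta>0_def)
    have f\<beta>: "f w = f' (\<beta>0 w)" for w
      by (rule substitution_eqI[OF f substitution_comp[OF f' \<beta>0]]) (simp add: f\<beta>1)
    have \<beta>0S: "\<beta>0 w \<in> lists S" if "w \<in> lists S" for w
      by (rule substitution_lists[OF \<beta>0 _ that]) (use ab in \<open>auto simp: \<beta>0_def\<close>)
    have less': "(\<Sum>c\<in>S. length (f' [c])) < (\<Sum>c\<in>S. length (f [c]))"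
    proof (rule sum_strict_mono_ex1)
      show "\<forall>c\<in>S. length (f' [c]) \<le> length (f [c])" by (simp add: f'_def t)
      have "length (f' [b]) < length (f [b])" using False ab(1) by (simp add: f'_def t)
      then show "\<exists>c\<in>S. length (f' [c]) < length (f [c])" using ab(2) by blast
    qed (rule assms(1))
    \<comment> \<open>Images under \<open>\<beta>0\<close> never begin with \<open>b\<close>, as
      \<open>b\<close> itself is sent to \<open>[a, b]\<close>. Hence the two images compared below
      agree in their first letter \<open>a\<close> but not in the rest, and non-injectivity passes
      to \<open>f'\<close>.\<close>
    have hd: "\<beta>0 u' \<noteq> b # w" for w
      by (cases u') (use ab(5) in \<open>auto simp: \<beta>0_def\<close>)
    have "\<beta>0 (a # u') \<noteq> \<beta>0 (b # v')"
      using hd ab(5) by (auto simp: \<beta>0_def)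
    moreover have "f' (\<beta>0 (a # u')) = f' (\<beta>0 (b # v'))" using ab(6) f\<beta> by metis
    moreover have "\<beta>0 (a # u') \<in> lists S" "\<beta>0 (b # v') \<in> lists S" using \<beta>0S ab by auto
    ultimately have "\<not> inj_on f' (lists S)" using inj_onD by metis
    note IH = less.hyps[OF less' f' this]
    obtain d \<alpha> \<beta> where d: "d \<in> S" "substitution \<alpha>" "substitution \<beta>"
      "\<And>a. a \<in> S \<Longrightarrow> \<beta> [a] \<in> lists (S - {d})" "\<And>a. a \<in> S \<Longrightarrow> f' [a] = \<alpha> (\<beta> [a])"
      "\<And>c. c \<in> S \<Longrightarrow> set (\<alpha> [c]) \<subseteq> (\<Union>a\<in>S. set (f' [a]))"
      using IH by (elim bexE exE conjE) blast
    have f'\<alpha>: "f' w = \<alpha> (\<beta> w)" if "w \<in> lists S" for w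
      by (rule substitution_eqI[OF f' substitution_comp[OF d(2,3)]]) (use that d(5) in auto)
    have "set (f' [c]) \<subseteq> set (f [c])" for c by (simp add: f'_def t)
    then have A: "set (\<alpha> [c]) \<subseteq> (\<Union>a\<in>S. set (f [a]))" if "c \<in> S" for c
      using d(6)[OF that] by blast
    have B: "\<beta> (\<beta>0 [c]) \<in> lists (S - {d}) \<and> f [c] = \<alpha> (\<beta> (\<beta>0 [c]))" if "c \<in> S" for c
    proof -
      have "\<beta>0 [c] \<in> lists S" using \<beta>0S[of "[c]"] that by simp
      then show ?thesis using f\<beta>1 f'\<alpha> substitution_lists[OF d(3) d(4)] by simp
    qed
    show ?thesis
      by (rule bexI[OF _ d(1)], rule exI[of _ \<alpha>], rule exI[of _ "\<lambda>u. \<beta> (\<beta>0 u)"])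
        (intro conjI d(2) substitution_comp[OF d(3) \<beta>0] ballI A B; assumption?)
  qed
qed

text \<open>Induction on the number of letters. If \<open>f\<close> is not injective, it factors as
  \<open>\<alpha>\<close> after \<open>\<beta>\<close> through fewer letters; then \<open>g\<close>,
  the product in the other order, acts on the smaller alphabet, and \<open>f ^^ Suc n\<close> is
  \<open>g ^^ n\<close> framed by \<open>\<beta>\<close> and \<open>\<alpha>\<close>. An exponent
  \<open>p\<close> for \<open>g\<close> gives \<open>Suc p\<close> for \<open>f\<close>. The
  shrinking alphabet is the reason for working on \<open>lists S\<close>.\<close>

lemma kernel_stabilizes_on:
  assumes "finite S" "substitution f" "\<And>a. a \<in> S \<Longrightarrow> f [a] \<in> lists S"
  shows "\<exists>p. \<forall>u\<in>lists S. \<forall>v\<in>lists S. (f ^^ Suc p) u = (f ^^ Suc p) v \<longrightarrow> (f ^^ p) u = (f ^^ p) v"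
  using assms
proof (induction "card S" arbitrary: S f rule: less_induct)
  case less
  note f = less.prems(2)
  show ?case
  proof (cases "inj_on f (lists S)")
    case True
    then show ?thesis by (intro exI[of _ 0]) (auto simp: inj_on_def)
  next
    case False
    obtain b \<alpha> \<beta> where b: "b \<in> S" "substitution \<alpha>" "substitution \<beta>"
      "\<And>a. a \<in> S \<Longrightarrow> \<beta> [a] \<in> lists (S - {b})" "\<And>a. a \<in> S \<Longrightarrow> f [a] = \<alpha> (\<beta> [a])"
      "\<And>c. c \<in> S \<Longrightarrow> set (\<alpha> [c]) \<subseteq> (\<Union>a\<in>S. set (f [a]))"
      using non_injective_factorization[OF less.prems(1) f False] by (elim bexE exE conjE) blast
    define g where "g = (\<lambda>u. \<beta> (\<alpha> u))"
    have g: "substitution g" unfolding g_def by (rule substitution_comp[OF b(3,2)])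
    have f\<alpha>: "f u = \<alpha> (\<beta> u)" if "u \<in> lists S" for u
      by (rule substitution_eqI[OF f substitution_comp[OF b(2,3)]]) (use that b(5) in auto)
    \<comment> \<open>The bound on the letters of \<open>\<alpha> [c]\<close> in the factorization
      serves to keep \<open>\<alpha>\<close> inside \<open>lists S\<close>, so that \<open>g\<close>
      can be iterated.\<close>
    have \<alpha>S: "\<alpha> u \<in> lists S" if "u \<in> lists (S - {b})" for u
      by (rule substitution_lists[OF b(2) _ that]) (use b(6) less.prems(3) in fastforce)
    have \<beta>S: "\<beta> u \<in> lists (S - {b})" if "u \<in> lists S" for u
      by (rule substitution_lists[OF b(3,4) that])
    have gS: "g u \<in> lists (S - {b})" if "u \<in> lists (S - {b})" for u
      unfolding g_def using \<alpha>S \<beta>S that by blast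
    have "\<exists>p. \<forall>u\<in>lists (S - {b}). \<forall>v\<in>lists (S - {b}).
        (g ^^ Suc p) u = (g ^^ Suc p) v \<longrightarrow> (g ^^ p) u = (g ^^ p) v"
    proof (rule less.hyps)
      show "card (S - {b}) < card S" by (rule card_Diff1_less[OF less.prems(1) b(1)])
      show "finite (S - {b})" using less.prems(1) by simp
      show "substitution g" by (rule g)
      show "g [a] \<in> lists (S - {b})" if "a \<in> S - {b}" for a using gS[of "[a]"] that by simp
    qed
    then obtain p where p: "\<And>u v. u \<in> lists (S - {b}) \<Longrightarrow> v \<in> lists (S - {b}) \<Longrightarrow>
        (g ^^ Suc p) u = (g ^^ Suc p) v \<Longrightarrow> (g ^^ p) u = (g ^^ p) v" by blast
    have gpow: "(g ^^ n) u \<in> lists (S - {b})" if "u \<in> lists (S - {b})" for n u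
      by (induction n) (use that gS in auto)
    have fpow: "(f ^^ Suc n) u = \<alpha> ((g ^^ n) (\<beta> u))" if "u \<in> lists S" for n u
    proof (induction n)
      case 0 then show ?case using f\<alpha>[OF that] by simp
    next
      case (Suc n)
      have "(f ^^ Suc (Suc n)) u = f (\<alpha> ((g ^^ n) (\<beta> u)))" using Suc by simp
      also have "\<dots> = \<alpha> (g ((g ^^ n) (\<beta> u)))"
        using f\<alpha> \<alpha>S gpow \<beta>S that unfolding g_def by blast
      finally show ?case by simp
    qed
    have "(f ^^ Suc p) u = (f ^^ Suc p) v"
      if u: "u \<in> lists S" and v: "v \<in> lists S" and eq: "(f ^^ Suc (Suc p)) u = (f ^^ Suc (Suc p)) v"
      for u v
    proof -
      \<comment> \<open>Applying \<open>\<beta>\<close> turns the equality for \<open>f\<close> into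
        one for \<open>g ^^ Suc (Suc p)\<close>. The induction hypothesis is then used twice, to
        descend to \<open>g ^^ p\<close>.\<close>
      have "\<beta> (\<alpha> ((g ^^ Suc p) (\<beta> u))) = \<beta> (\<alpha> ((g ^^ Suc p) (\<beta> v)))"
        using eq fpow[OF u] fpow[OF v] by metis
      then have "g ((g ^^ Suc p) (\<beta> u)) = g ((g ^^ Suc p) (\<beta> v))" by (simp only: g_def)
      then have "(g ^^ Suc p) (g (\<beta> u)) = (g ^^ Suc p) (g (\<beta> v))"
        by (metis funpow.simps(2) funpow_swap1 o_apply)
      then have "(g ^^ p) (g (\<beta> u)) = (g ^^ p) (g (\<beta> v))"
        using p gS \<beta>S u v by meson
      then have "(g ^^ Suc p) (\<beta> u) = (g ^^ Suc p) (\<beta> v)"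
        by (metis funpow.simps(2) funpow_swap1 o_apply)
      then have "(g ^^ p) (\<beta> u) = (g ^^ p) (\<beta> v)" using p \<beta>S u v by meson
      then show ?thesis using fpow[OF u] fpow[OF v] by metis
    qed
    then show ?thesis by blast
  qed
qed

lemma kernel_stabilizes:
  fixes f :: "'a::finite list \<Rightarrow> 'a list"
  assumes "substitution f"
  shows "\<exists>p. \<forall>u v. (f ^^ Suc p) u = (f ^^ Suc p) v \<longrightarrow> (f ^^ p) u = (f ^^ p) v"
  using kernel_stabilizes_on[of "UNIV :: 'a set" f] assms by simp

section \<open>The language of a primitive aperiodic substitution\<close>

definition language :: "('a list \<Rightarrow> 'a list) \<Rightarrow> 'a list set" where
  "language \<tau> = {w. \<exists>a n. sublist w ((\<tau> ^^ n) [a])}"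

lemma language_sublist: "w \<in> language \<tau> \<Longrightarrow> sublist u w \<Longrightarrow> u \<in> language \<tau>"
  unfolding language_def by (auto intro: sublist_order.order_trans)

lemma subst_subshift_iff: "x \<in> subst_subshift \<tau> \<longleftrightarrow> (\<forall>i j. map x [i..<j] \<in> language \<tau>)"
  unfolding subst_subshift_def factors_def language_def by blast

lemma length_le_substitution:
  assumes "substitution f" "\<And>a. f [a] \<noteq> []"
  shows "length u \<le> length (f u)"
proof (induction u)
  case (Cons a u)
  have "length (f [a]) \<ge> 1" using assms(2)[of a] by (simp add: Suc_le_eq)
  then show ?case using Cons substitution_Cons[OF assms(1), of a u] by simp
qed simp

lemma length_substitution_le:
  assumes "substitution f" "\<And>a. length (f [a]) \<le> M"
  shows "length (f u) \<le> M * length u"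
proof (induction u)
  case Nil then show ?case by (simp add: substitution_Nil[OF assms(1)])
next
  case (Cons a u)
  then show ?case using assms(2)[of a] substitution_Cons[OF assms(1), of a u] by simp
qed

lemma length_substitution_ge:
  assumes "substitution f" "\<And>a. m \<le> length (f [a])"
  shows "m * length u \<le> length (f u)"
proof (induction u)
  case Nil then show ?case by simp
next
  case (Cons a u)
  then show ?case using assms(2)[of a] substitution_Cons[OF assms(1), of a u] by simp
qed

lemma substitution_sublist:
  assumes "substitution f" "sublist u v"
  shows "sublist (f u) (f v)"
proof -
  obtain s t where "v = s @ u @ t" using assms(2) by (auto simp: sublist_def)
  then show ?thesis using substitution_append[OF assms(1)] by simp
qed

locale aperiodic_primitive =
  fixes \<tau> :: "'a::finite list \<Rightarrow> 'a list"
  assumes subst: "substitution \<tau>"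
    and primitive: "primitive_subst \<tau>"
    and aperiodic: "aperiodic_subst \<tau>"
    and nonempty: "subst_subshift \<tau> \<noteq> {}"
begin

abbreviation L :: "'a list set" where "L \<equiv> language \<tau>"

abbreviation X :: "(nat \<Rightarrow> 'a) set" where "X \<equiv> subst_subshift \<tau>"

lemma power: "substitution (\<tau> ^^ n)"
  by (rule substitution_funpow[OF subst])

lemma power_Nil [simp]: "(\<tau> ^^ n) [] = []"
  by (rule substitution_Nil[OF power])

lemmas power_append = substitution_append[OF power]

lemma power_add: "(\<tau> ^^ (m + n)) u = (\<tau> ^^ m) ((\<tau> ^^ n) u)"
  by (simp add: funpow_add)

lemma letters_occur: "\<exists>N. \<forall>n\<ge>N. \<forall>a b. sublist [a] ((\<tau> ^^ n) [b])"
proof -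
  have "\<forall>\<^sub>F n in sequentially. \<forall>p\<in>UNIV. sublist [fst p] ((\<tau> ^^ n) [snd p])"
    using primitive by (subst eventually_ball_finite_distrib) (auto simp: primitive_subst_def)
  then show ?thesis by (auto simp: eventually_sequentially)
qed

text \<open>A letter erased once is erased by all higher powers, but primitivity puts
  \<open>a\<close> into its own images.\<close>

lemma nonerasing: "\<tau> [a] \<noteq> []"
proof
  assume "\<tau> [a] = []"
  then have "(\<tau> ^^ Suc n) [a] = []" for n
    by (simp only: funpow_Suc_right o_apply) simp
  moreover obtain N where "sublist [a] ((\<tau> ^^ Suc N) [a])"
    using letters_occur by (metis le_SucI order_refl)
  ultimately show False by (metis sublist_Cons_Nil)
qed

lemma power_nonerasing: "(\<tau> ^^ n) [a] \<noteq> []"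
proof (induction n)
  case (Suc n)
  then show ?case
    using length_le_substitution[OF subst nonerasing, of "(\<tau> ^^ n) [a]"] by auto
qed simp

lemmas length_le_power = length_le_substitution[OF power power_nonerasing]

lemma power_eq_Nil [simp]: "(\<tau> ^^ n) u = [] \<longleftrightarrow> u = []"
  using length_le_power[of u n] by auto

lemma length_power_mono: "m \<le> n \<Longrightarrow> length ((\<tau> ^^ m) u) \<le> length ((\<tau> ^^ n) u)"
  using length_le_power[of "(\<tau> ^^ m) u" "n - m"] power_add[of "n - m" m u] by simp

lemma language_occurs:
  assumes "w \<in> L"
  shows "\<exists>N. \<forall>n\<ge>N. \<forall>b. sublist w ((\<tau> ^^ n) [b])"
proof -
  obtain a m where m: "sublist w ((\<tau> ^^ m) [a])" using assms by (auto simp: language_def)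
  obtain N where N: "\<And>n b. n \<ge> N \<Longrightarrow> sublist [a] ((\<tau> ^^ n) [b])" using letters_occur by blast
  have "sublist w ((\<tau> ^^ n) [b])" if "n \<ge> m + N" for n b
  proof -
    have "sublist ((\<tau> ^^ m) [a]) ((\<tau> ^^ m) ((\<tau> ^^ (n - m)) [b]))"
      using substitution_sublist[OF power N] that by simp
    then show ?thesis using m power_add[of m "n - m"] that
      by (metis add_leD1 le_add_diff_inverse sublist_order.order_trans)
  qed
  then show ?thesis by blast
qed

lemma power_in_language:
  assumes "w \<in> L"
  shows "(\<tau> ^^ n) w \<in> L"
proof -
  obtain a m where m: "sublist w ((\<tau> ^^ m) [a])" using assms by (auto simp: language_def)
  then have "sublist ((\<tau> ^^ n) w) ((\<tau> ^^ (n + m)) [a])"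
    unfolding power_add by (rule substitution_sublist[OF power])
  then show ?thesis by (auto simp: language_def)
qed

lemma letter_in_language: "[a] \<in> L"
  unfolding language_def by (auto intro!: exI[of _ a] exI[of _ 0])

text \<open>The exponent that witnesses \<open>w \<in> L\<close> may be smaller than
  \<open>n\<close>. Primitivity lets it be raised to \<open>n + N\<close>, after which the outer
  \<open>n\<close> applications can be peeled off.\<close>

lemma language_desubstitute:
  assumes "w \<in> L"
  shows "\<exists>v\<in>L. sublist w ((\<tau> ^^ n) v)"
proof -
  obtain N where N: "\<And>m b. m \<ge> N \<Longrightarrow> sublist w ((\<tau> ^^ m) [b])"
    using language_occurs[OF assms] by blast
  have "sublist w ((\<tau> ^^ n) ((\<tau> ^^ N) [b]))" for b
    using N[of "n + N" b] by (simp add: power_add)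
  then show ?thesis using power_in_language[OF letter_in_language] by blast
qed

text \<open>Over a single letter the only sequence is constant, hence periodic. Two letters are what
  makes some power of \<open>\<tau>\<close> at least double all lengths.\<close>

lemma two_letters: "\<exists>a b :: 'a. a \<noteq> b"
proof (rule ccontr)
  assume "\<nexists>a b :: 'a. a \<noteq> b"
  then have eq: "a = b" for a b :: 'a by blast
  obtain x where "x \<in> X" using nonempty by blast
  moreover have "(shift ^^ 1) x = x" using eq by (intro ext)
  ultimately show False
    using aperiodic unfolding aperiodic_subst_def no_periodic_points_def periodic_point_def by blast
qed

section \<open>Growth and comparability of the images of letters\<close>

lemma growth: "\<exists>n. \<forall>a. N \<le> length ((\<tau> ^^ n) [a])"
proof -
  obtain a b :: 'a where ab: "a \<noteq> b" using two_letters by blast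
  obtain k where k: "\<And>c d. sublist [c] ((\<tau> ^^ k) [d])" using letters_occur by blast
  have ge2: "2 \<le> length ((\<tau> ^^ k) [d])" for d
  proof -
    have "{a, b} \<subseteq> set ((\<tau> ^^ k) [d])"
      using set_mono_sublist[OF k[of a d]] set_mono_sublist[OF k[of b d]] by simp
    then have "card {a, b} \<le> card (set ((\<tau> ^^ k) [d]))" by (intro card_mono) auto
    also have "\<dots> \<le> length ((\<tau> ^^ k) [d])" by (rule card_length)
    finally show ?thesis using ab by simp
  qed
  have "2 ^ j \<le> length ((\<tau> ^^ (k * j)) [d])" for j d
  proof (induction j)
    case (Suc j)
    have "2 ^ Suc j \<le> 2 * length ((\<tau> ^^ (k * j)) [d])" using Suc by simp
    also have "\<dots> \<le> length ((\<tau> ^^ k) ((\<tau> ^^ (k * j)) [d]))"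
      by (rule length_substitution_ge[OF power ge2])
    finally show ?case using power_add[of k "k * j"] by simp
  qed simp
  then show ?thesis using less_exp[of N] by (meson le_trans less_imp_le)
qed

definition max_len :: "nat \<Rightarrow> nat" where
  "max_len n = Max (range (\<lambda>a. length ((\<tau> ^^ n) [a])))"

lemma le_max_len: "length ((\<tau> ^^ n) [a]) \<le> max_len n"
  unfolding max_len_def by (rule Max_ge) auto

lemmas power_le_max_len = length_substitution_le[OF power le_max_len]

lemma max_len_pos: "0 < max_len n"
  using le_max_len[of n] power_nonerasing[of n] by (metis gr0I le_zero_eq length_0_conv)

lemma max_len_mono: "m \<le> n \<Longrightarrow> max_len m \<le> max_len n"
  unfolding max_len_def
  by (rule Max.boundedI) (auto intro: order_trans[OF length_power_mono le_max_len[unfolded max_len_def]])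

lemma max_len_add_le: "max_len (m + n) \<le> max_len m * max_len n"
proof -
  have "length ((\<tau> ^^ (m + n)) [a]) \<le> max_len m * max_len n" for a
    unfolding power_add using power_le_max_len[of m "(\<tau> ^^ n) [a]"] le_max_len[of n a]
    by (meson le_trans mult_le_mono2)
  then show ?thesis unfolding max_len_def[of "m + n"] by (intro Max.boundedI) auto
qed

text \<open>For \<open>n \<ge> k\<close> the word \<open>(\<tau> ^^ n) [a]\<close> contains
  \<open>(\<tau> ^^ (n - k)) [b]\<close> for every \<open>b\<close>, so it is at least as long as
  \<open>max_len (n - k)\<close>, and \<open>k\<close> further steps multiply lengths by at most
  \<open>max_len k\<close>.\<close>

lemma distortion: "\<exists>C>0. \<forall>n a. max_len n \<le> C * length ((\<tau> ^^ n) [a])"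
proof -
  obtain k where k: "\<And>a b. sublist [a] ((\<tau> ^^ k) [b])" using letters_occur by blast
  have "max_len n \<le> max_len k * length ((\<tau> ^^ n) [a])" for n a
  proof (cases "k \<le> n")
    case True
    have "length ((\<tau> ^^ (n - k)) [b]) \<le> length ((\<tau> ^^ n) [a])" for b
      using sublist_length_le[OF substitution_sublist[OF power k[of b a]], of "n - k"]
        power_add[of "n - k" k "[a]"] True by simp
    then have "max_len (n - k) \<le> length ((\<tau> ^^ n) [a])"
      unfolding max_len_def by (intro Max.boundedI) auto
    then show ?thesis using max_len_add_le[of k "n - k"] True
      by (metis le_add_diff_inverse le_trans mult_le_mono2)
  next
    case False
    then have "max_len n \<le> max_len k" by (intro max_len_mono) simp
    also have "\<dots> \<le> max_len k * length ((\<tau> ^^ n) [a])"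
      using power_nonerasing[of n a] by (simp add: Suc_le_eq)
    finally show ?thesis .
  qed
  then show ?thesis using max_len_pos by blast
qed

lemma long_power_word: "\<exists>w\<in>L. length w = N"
proof -
  obtain n where "\<forall>a. N \<le> length ((\<tau> ^^ n) [a])" using growth by blast
  then have "length (take N ((\<tau> ^^ n) [undefined])) = N" by simp
  moreover have "take N ((\<tau> ^^ n) [undefined]) \<in> L"
    using language_sublist[OF power_in_language[OF letter_in_language]] by blast
  ultimately show ?thesis by blast
qed

text \<open>The minimal covers \<open>(v, s)\<close> of \<open>w\<close>: it occurs in \<open>f v\<close> at offset \<open>s\<close>, and neither end letter of
  \<open>v\<close> can be dropped.\<close>

definition reps :: "('a list \<Rightarrow> 'a list) \<Rightarrow> 'a list \<Rightarrow> ('a list \<times> nat) set" where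
  "reps f w = {(v, s). v \<in> L \<and> v \<noteq> [] \<and> s < length (f [hd v]) \<and>
     length (f (butlast v)) < s + length w \<and> (\<exists>p t. f v = p @ w @ t \<and> length p = s)}"

lemma reps_trim:
  assumes f: "substitution f" and "v \<in> L" "w \<noteq> []" "f v = p @ w @ t"
  shows "\<exists>a v' b s. v = a @ v' @ b \<and> (v', s) \<in> reps f w \<and> length p = length (f a) + s"
  using assms(2,4)
proof (induction "length v" arbitrary: v p t rule: less_induct)
  case less
  have v: "v \<noteq> []" using less.prems(2) assms(3) substitution_Nil[OF f] by auto
  consider "length (f [hd v]) \<le> length p" | "length p + length w \<le> length (f (butlast v))"
    | "length p < length (f [hd v])" "length (f (butlast v)) < length p + length w" by linarith
  then show ?case
  proof cases
    case 1
    have fv: "f [hd v] @ f (tl v) = p @ w @ t"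
      using less.prems(2) substitution_append[OF f, of "[hd v]" "tl v"] v by simp
    obtain p' where p': "p = f [hd v] @ p'" "f (tl v) = p' @ w @ t"
      using append_eq_append_le[OF fv 1] by blast
    have "length (tl v) < length v" using v by simp
    from less.hyps[OF this language_sublist[OF less.prems(1) sublist_tl] p'(2)]
    obtain a v' b s where *: "tl v = a @ v' @ b" "(v', s) \<in> reps f w"
      "length p' = length (f a) + s" by (elim exE conjE)
    have "v = (hd v # a) @ v' @ b" using *(1) v by (metis append_Cons list.collapse)
    moreover have "length p = length (f (hd v # a)) + s"
      using *(3) p'(1) substitution_Cons[OF f, of "hd v" a] by simp
    ultimately show ?thesis using *(2) by blast
  next
    case 2
    have "f (butlast v) @ f [last v] = (p @ w) @ t"
      using less.prems(2) substitution_append[OF f, of "butlast v" "[last v]"] v by simp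
    then obtain t' where t': "f (butlast v) = p @ w @ t'"
      using append_eq_append_le[of "p @ w" t] 2 by (metis append.assoc length_append)
    have "length (butlast v) < length v" using v by simp
    from less.hyps[OF this language_sublist[OF less.prems(1) sublist_butlast] t']
    obtain a v' b s where *: "butlast v = a @ v' @ b" "(v', s) \<in> reps f w"
      "length p = length (f a) + s" by (elim exE conjE)
    have "v = a @ v' @ (b @ [last v])" using *(1) v by (metis append.assoc append_butlast_last_id)
    then show ?thesis using *(2,3) by blast
  next
    case 3
    then have "(v, length p) \<in> reps f w"
      using less.prems v by (auto simp: reps_def)
    then show ?thesis
      by (intro exI[of _ "[]"] exI[of _ v] exI[of _ "length p"]) (simp add: substitution_Nil[OF f])
  qed
qed

lemma reps_exist:
  assumes "w \<in> L" "w \<noteq> []"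
  shows "\<exists>v s. (v, s) \<in> reps (\<tau> ^^ n) w"
proof -
  obtain v where "v \<in> L" "sublist w ((\<tau> ^^ n) v)" using language_desubstitute[OF assms(1)] by blast
  then show ?thesis using reps_trim[OF power _ assms(2)] by (metis sublist_def)
qed

lemma reps_length_le:
  assumes "(v, s) \<in> reps f w" "substitution f" "\<And>a. m \<le> length (f [a])" "\<And>a. length (f [a]) \<le> M"
  shows "m * (length v - 1) < M + length w"
proof -
  have "m * length (butlast v) \<le> length (f (butlast v))"
    by (rule length_substitution_ge[OF assms(2,3)])
  also have "\<dots> < s + length w" using assms(1) by (simp add: reps_def)
  also have "\<dots> \<le> M + length w" using assms(1) assms(4)[of "hd v"] by (simp add: reps_def)
  finally show ?thesis by simp
qed

lemma finite_reps:
  assumes "substitution f" "\<And>a. f [a] \<noteq> []"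
  shows "finite (reps f w)"
proof -
  define M where "M = Max (range (\<lambda>a. length (f [a])))"
  have M: "length (f [a]) \<le> M" for a unfolding M_def by (rule Max_ge) auto
  have "v \<in> {v. set v \<subseteq> UNIV \<and> length v \<le> M + length w}" "s < M" if "(v, s) \<in> reps f w" for v s
  proof -
    have "1 * (length v - 1) < M + length w"
      by (rule reps_length_le[OF that assms(1) _ M]) (use assms(2) in \<open>simp add: Suc_le_eq\<close>)
    then show "v \<in> {v. set v \<subseteq> UNIV \<and> length v \<le> M + length w}" by auto
    show "s < M" using that M[of "hd v"] by (auto simp: reps_def)
  qed
  then have "reps f w \<subseteq> {v. set v \<subseteq> UNIV \<and> length v \<le> M + length w} \<times> {..<M}"
    by (intro subrelI) blast
  then show ?thesis
    by (rule finite_subset) (intro finite_cartesian_product finite_lists_length_le finite_lessThan finite)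
qed

text \<open>A word \<open>w\<close> of length at most \<open>d\<close> lies in \<open>\<tau>\<^sup>k u\<close> with \<open>u\<close> of length at most 2, for the first \<open>k\<close>
  with all \<open>\<tau>\<^sup>k a\<close> of length at least \<open>d\<close>; and the finitely many such \<open>u\<close> occur in every \<open>\<tau>\<^sup>m b\<close>.\<close>

lemma linear_recurrence:
  "\<exists>K>0. \<forall>d>0. \<forall>w\<in>L. \<forall>W\<in>L. length w \<le> d \<longrightarrow> K * d \<le> length W \<longrightarrow> sublist w W"
proof -
  obtain C where C: "C > 0" "\<And>n a. max_len n \<le> C * length ((\<tau> ^^ n) [a])"
    using distortion by blast
  define U where "U = {u \<in> L. length u \<le> 2}"
  have "finite U"
    using finite_subset[OF _ finite_lists_length_le[of "UNIV :: 'a set" 2], of U] by (auto simp: U_def)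
  then have "\<forall>\<^sub>F n in sequentially. \<forall>u\<in>U. \<forall>b. sublist u ((\<tau> ^^ n) [b])"
    using language_occurs
    by (subst eventually_ball_finite_distrib) (auto simp: U_def eventually_sequentially)
  then obtain m where m: "\<And>u b. u \<in> U \<Longrightarrow> sublist u ((\<tau> ^^ m) [b])"
    by (auto simp: eventually_sequentially)
  \<comment> \<open>For the first admissible \<open>k\<close>, \<open>max_len k\<close> is at most
    \<open>max_len 1 * (C * d)\<close>, because some letter has an image shorter than
    \<open>d\<close> one step earlier. The factor \<open>max_len m\<close> pays for \<open>m\<close>
    more steps, and 3 forces a minimal cover of \<open>W\<close> to have an inner letter.\<close>
  define K where "K = 3 * (max_len m * (max_len 1 * C))"
  have main: "sublist w W"
    if d: "d > 0" and w: "w \<in> L" and W: "W \<in> L" and wd: "length w \<le> d" and Wd: "K * d \<le> length W"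
    for d w W
  proof (cases "w = []")
    case False
    define P where "P k \<longleftrightarrow> (\<forall>a. d \<le> length ((\<tau> ^^ k) [a]))" for k
    obtain k where k: "P k" "\<And>j. j < k \<Longrightarrow> \<not> P j"
      using growth[of d] exists_least_iff[of P] by (auto simp: P_def)
    have "max_len k \<le> max_len 1 * (C * d)"
    proof (cases k)
      case 0
      have "C * d > 0" "max_len 1 > 0" using C(1) d max_len_pos by auto
      moreover have "max_len k = 1" using 0 by (simp add: max_len_def)
      ultimately show ?thesis by (metis One_nat_def Suc_leI mult_pos_pos)
    next
      case (Suc j)
      then obtain a where a: "length ((\<tau> ^^ j) [a]) < d" using k(2)[of j] by (auto simp: P_def not_le)
      have "max_len j \<le> C * d" using C(2)[of j a] a by (meson le_trans less_imp_le mult_le_mono2)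
      then show ?thesis using max_len_add_le[of 1 j] Suc by (simp add: le_trans)
    qed
    then have "max_len (m + k) \<le> max_len m * (max_len 1 * (C * d))"
      using max_len_add_le[of m k] by (meson le_trans mult_le_mono2)
    then have W': "3 * max_len (m + k) \<le> length W" using Wd by (simp add: K_def algebra_simps)
    obtain u s where u: "(u, s) \<in> reps (\<tau> ^^ k) w" using reps_exist[OF w False] by blast
    \<comment> \<open>The inner letters of a minimal cover map strictly inside \<open>w\<close>,
      hence to fewer than \<open>d\<close> letters in total. As each single image has length at
      least \<open>d\<close>, there are none.\<close>
    have "d * (length u - 1 - 1) < d"
    proof -
      have "length ((\<tau> ^^ k) (butlast u)) < s + length w" "s < length ((\<tau> ^^ k) [hd u])"
        and "u \<noteq> []" using u by (auto simp: reps_def)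
      show ?thesis
      proof (cases "length u \<le> 1")
        case False
        then have "butlast u = [hd u] @ tl (butlast u)"
          by (cases u) auto
        then have "length ((\<tau> ^^ k) (butlast u)) =
            length ((\<tau> ^^ k) [hd u]) + length ((\<tau> ^^ k) (tl (butlast u)))"
          by (metis length_append power_append)
        then have "length ((\<tau> ^^ k) (tl (butlast u))) < d"
          using \<open>length ((\<tau> ^^ k) (butlast u)) < s + length w\<close> \<open>s < length ((\<tau> ^^ k) [hd u])\<close> wd
          by linarith
        moreover have "d * length (tl (butlast u)) \<le> length ((\<tau> ^^ k) (tl (butlast u)))"
          by (rule length_substitution_ge[OF power]) (use k(1) in \<open>simp add: P_def\<close>)
        ultimately have "d * length (tl (butlast u)) < d" by linarith
        then show ?thesis by simp
      qed (use d in simp)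
    qed
    then have "length u \<le> 2" using d by simp
    then have "u \<in> U" using u by (auto simp: U_def reps_def)
    obtain Z r where Z: "(Z, r) \<in> reps (\<tau> ^^ (m + k)) W"
      using reps_exist[OF W, of "m + k"] W' max_len_pos[of "m + k"] by fastforce
    then obtain p t where pt: "(\<tau> ^^ (m + k)) Z = p @ W @ t" "length p = r" "Z \<noteq> []"
      "r < length ((\<tau> ^^ (m + k)) [hd Z])" "length ((\<tau> ^^ (m + k)) (butlast Z)) < r + length W"
      by (auto simp: reps_def)
    have "length Z \<ge> 3"
    proof (rule ccontr)
      assume "\<not> length Z \<ge> 3"
      then have "max_len (m + k) * length Z \<le> max_len (m + k) * 2" by (intro mult_le_mono2) simp
      moreover have "length W \<le> length ((\<tau> ^^ (m + k)) Z)" using pt(1) by simp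
      ultimately have "length W \<le> 2 * max_len (m + k)"
        using power_le_max_len[of "m + k" Z] by linarith
      then show False using W' max_len_pos[of "m + k"] by linarith
    qed
    then obtain z0 z1 z2 zs where Z': "Z = z0 # z1 # z2 # zs"
      by (auto simp: numeral_3_eq_3 Suc_le_length_iff)
    let ?f = "\<tau> ^^ (m + k)"
    \<comment> \<open>Only the images of the first and last letters of a minimal cover can stick out
      of \<open>W\<close>.\<close>
    have "sublist (?f [z1]) W"
    proof -
      have "butlast Z = [z0] @ [z1] @ butlast (z2 # zs)" using Z' by simp
      then have *: "length (?f [z0]) + length (?f [z1]) \<le> length (?f (butlast Z))"
        by (simp only: power_append length_append)
      have "Z = [z0] @ [z1] @ (z2 # zs)" using Z' by simp
      then have eq: "?f [z0] @ ?f [z1] @ ?f (z2 # zs) = p @ W @ t"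
        using pt(1) by (metis power_append)
      then obtain q where q: "?f [z0] = p @ q"
        using pt(2,4) Z' by (auto simp: append_eq_append_conv2)
      then have "(q @ ?f [z1]) @ ?f (z2 # zs) = W @ t" using eq by simp
      moreover have "length (q @ ?f [z1]) \<le> length W" using * q pt(2,5) by simp
      ultimately obtain q' where "W = (q @ ?f [z1]) @ q'" by (auto simp: append_eq_append_conv2)
      then show ?thesis by (auto simp: sublist_def)
    qed
    moreover have "sublist ((\<tau> ^^ k) u) (?f [z1])"
      using substitution_sublist[OF power m[OF \<open>u \<in> U\<close>], of k z1] power_add[of k m "[z1]"]
      by (simp add: add.commute)
    moreover have "sublist w ((\<tau> ^^ k) u)" using u by (auto simp: reps_def)
    ultimately show ?thesis by (meson sublist_order.order_trans)
  qed simp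
  have "K > 0" using C(1) max_len_pos by (simp add: K_def)
  then show ?thesis by (intro exI[of _ K] conjI allI ballI impI main)
qed

text \<open>A word with period \<open>d\<close> that is too long contains, by linear recurrence,
  every word of length \<open>d + 1\<close> in the language. All of these then begin and end with
  the same letter, so every point of the subshift has period \<open>d\<close>. Since
  \<open>d + 1 \<le> 2 * d\<close>, twice the recurrence constant works.\<close>

lemma power_bound:
  "\<exists>K>0. \<forall>W\<in>L. \<forall>d>0. (\<forall>i. i + d < length W \<longrightarrow> W ! i = W ! (i + d)) \<longrightarrow> length W < K * d"
proof -
  obtain K where K: "K > 0" "\<And>d w W. d > 0 \<Longrightarrow> w \<in> L \<Longrightarrow> W \<in> L \<Longrightarrow> length w \<le> d \<Longrightarrow>
      K * d \<le> length W \<Longrightarrow> sublist w W"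
    using linear_recurrence by blast
  obtain x where x: "x \<in> X" using nonempty by blast
  have bound: "length W < 2 * K * d"
    if W: "W \<in> L" and d: "d > 0" and per: "\<And>i. i + d < length W \<Longrightarrow> W ! i = W ! (i + d)" for W d
  proof (rule ccontr)
    assume "\<not> length W < 2 * K * d"
    then have "K * (2 * d) \<le> length W" by (simp add: algebra_simps)
    moreover have "K * (d + 1) \<le> K * (2 * d)" using d by (intro mult_le_mono2) simp
    ultimately have len: "K * (d + 1) \<le> length W" by (rule order_trans[rotated])
    have "x i = x (i + d)" for i
    proof -
      let ?w = "map x [i..<i + d + 1]"
      have "?w \<in> L" using x by (simp only: subst_subshift_iff)
      then have "sublist ?w W" by (intro K(2)[of "d + 1"] W len) simp_all
      then obtain s t where st: "W = s @ ?w @ t" by (auto simp: sublist_def)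
      then have "length s + d < length W" by simp
      then have "W ! length s = W ! (length s + d)" by (rule per)
      moreover have "W ! length s = x i" "W ! (length s + d) = x (i + d)"
        unfolding st by (simp_all add: nth_append del: upt_Suc)
      ultimately show ?thesis by simp
    qed
    then have "(shift ^^ d) x = x"
    proof -
      have "(shift ^^ n) x i = x (i + n)" for n i
        by (induction n arbitrary: i) (auto simp: shift_def)
      then show ?thesis using \<open>\<And>i. x i = x (i + d)\<close> by auto
    qed
    then show False
      using aperiodic x d
      unfolding aperiodic_subst_def no_periodic_points_def periodic_point_def by blast
  qed
  show ?thesis
  proof (intro exI[of _ "2 * K"] conjI ballI allI impI)
    fix W d
    assume "W \<in> L" "0 < d" and per: "\<forall>i. i + d < length W \<longrightarrow> W ! i = W ! (i + d)"
    show "length W < 2 * K * d"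
      by (rule bound[OF \<open>W \<in> L\<close> \<open>0 < d\<close> per[rule_format]])
  qed (use K(1) in simp)
qed

end

section \<open>Synchronizing words\<close>

context aperiodic_primitive
begin

text \<open>Only the position of the cut is forced, not the letters beside it; so the notion
  tolerates that \<open>\<tau>\<close> identifies letters.\<close>

definition synchronizing :: "'a list \<Rightarrow> 'a list \<Rightarrow> bool" where
  "synchronizing w1 w2 \<longleftrightarrow> w1 @ w2 \<in> L \<and>
     (\<forall>v\<in>L. \<forall>p t. \<tau> v = p @ w1 @ w2 @ t \<longrightarrow> (\<exists>v1 v2. v = v1 @ v2 \<and> \<tau> v1 = p @ w1))"

text \<open>Take one minimal cover \<open>(v, s)\<close>. As \<open>w\<close> is long, the image of
  the first letter of \<open>v\<close> ends within \<open>w\<close>, splitting it as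
  \<open>w1 @ w2\<close>. Since this pair does not synchronize, \<open>w\<close> also occurs in some
  image without a cut at that place; the minimal cover found there must differ from
  \<open>(v, s)\<close>.\<close>

lemma two_reps:
  assumes no_sync: "\<And>w1 w2. \<not> synchronizing w1 w2"
    and w: "w \<in> L" "max_len 1 \<le> length w"
  shows "\<exists>x\<in>reps \<tau> w. \<exists>y\<in>reps \<tau> w. x \<noteq> y"
proof -
  have ne: "w \<noteq> []" using w(2) max_len_pos[of 1] by auto
  obtain v s where vs: "(v, s) \<in> reps \<tau> w" using reps_exist[OF w(1) ne, of 1] by auto
  then obtain p t where v: "\<tau> v = p @ w @ t" "length p = s" "v \<noteq> []" "s < length (\<tau> [hd v])"
    by (auto simp: reps_def)
  have "p @ (w @ t) = \<tau> [hd v] @ \<tau> (tl v)"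
    using v(1,3) substitution_append[OF subst, of "[hd v]" "tl v"] by simp
  from append_eq_append_le[OF this] obtain w1 where w1: "\<tau> [hd v] = p @ w1" "w @ t = w1 @ \<tau> (tl v)"
    using v(2,4) by auto
  have "length w1 \<le> length w" using w(2) le_max_len[of 1 "hd v"] w1(1) by simp
  from append_eq_append_le[OF w1(2)[symmetric] this] obtain w2 where w2: "w = w1 @ w2" by blast
  have "w1 @ w2 \<in> L" using w(1) w2 by simp
  then obtain v' p' t' where v': "v' \<in> L" "\<tau> v' = p' @ w1 @ w2 @ t'"
    and no_cut: "\<And>v1 v2. v' = v1 @ v2 \<Longrightarrow> \<tau> v1 \<noteq> p' @ w1"
    using no_sync[of w1 w2] unfolding synchronizing_def by blast
  have v'w: "\<tau> v' = p' @ w @ t'" using v'(2) w2 by simp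
  from reps_trim[OF subst v'(1) ne this] obtain a v'' b s'' where
    tr: "v' = a @ v'' @ b" "(v'', s'') \<in> reps \<tau> w" "length p' = length (\<tau> a) + s''"
    by (elim exE conjE)
  have "(v'', s'') \<noteq> (v, s)"
  proof
    assume eq: "(v'', s'') = (v, s)"
    then have "\<tau> a @ p @ w @ t @ \<tau> b = p' @ w @ t'"
      using v'w v(1) tr(1) by (simp add: substitution_append[OF subst])
    then have "(\<tau> a @ p) @ (w @ t @ \<tau> b) = p' @ (w @ t')" by simp
    moreover have "length (\<tau> a @ p) = length p'" using tr(3) eq v(2) by simp
    ultimately have "p' = \<tau> a @ p" using append_eq_append_conv by metis
    then have "\<tau> (a @ [hd v]) = p' @ w1" using w1(1) by (simp add: substitution_append[OF subst])
    moreover have "v' = (a @ [hd v]) @ (tl v @ b)" using tr(1) eq v(3) by simp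
    ultimately show False using no_cut by blast
  qed
  then show ?thesis using vs tr(2) by blast
qed

text \<open>Minimality survives composition: the first letter of \<open>v\<close> comes from the
  first letter of \<open>u\<close> and the last from the last, so \<open>W\<close> still starts and
  ends in the images of the end letters of \<open>u\<close>.\<close>

lemma reps_compose:
  assumes vs: "(v, s) \<in> reps \<tau> W" and ur: "(u, r) \<in> reps (\<tau> ^^ n) v"
  shows "(u, length (\<tau> (take r ((\<tau> ^^ n) u))) + s) \<in> reps (\<tau> ^^ Suc n) W"
proof -
  obtain p t where v: "\<tau> v = p @ W @ t" "length p = s" "v \<noteq> []" "s < length (\<tau> [hd v])"
    "length (\<tau> (butlast v)) < s + length W" using vs by (auto simp: reps_def)
  obtain a b where u: "(\<tau> ^^ n) u = a @ v @ b" "length a = r" "u \<noteq> []" "u \<in> L"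
    "r < length ((\<tau> ^^ n) [hd u])" "length ((\<tau> ^^ n) (butlast u)) < r + length v"
    using ur by (auto simp: reps_def)
  have a: "take r ((\<tau> ^^ n) u) = a" using u(1,2) by simp
  have mono: "length (\<tau> x) \<le> length (\<tau> (x @ y))" for x y
    by (simp add: substitution_append[OF subst])
  have "length (\<tau> a) + s < length ((\<tau> ^^ Suc n) [hd u])"
  proof -
    have "(a @ [hd v]) @ (tl v @ b) = a @ v @ b" using v(3) by simp
    also have "\<dots> = (\<tau> ^^ n) [hd u] @ (\<tau> ^^ n) (tl u)"
      using u(1,3) power_append[of n "[hd u]" "tl u"] by simp
    finally have eq: "(a @ [hd v]) @ (tl v @ b) = (\<tau> ^^ n) [hd u] @ (\<tau> ^^ n) (tl u)" .
    have "length (a @ [hd v]) \<le> length ((\<tau> ^^ n) [hd u])" using u(2,5) by simp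
    then obtain c where "(\<tau> ^^ n) [hd u] = (a @ [hd v]) @ c"
      using append_eq_append_le[OF eq] by blast
    then have "length (\<tau> (a @ [hd v])) \<le> length ((\<tau> ^^ Suc n) [hd u])"
      using mono[of "a @ [hd v]" c] by simp
    then show ?thesis using v(4) by (simp add: substitution_append[OF subst])
  qed
  moreover have "length ((\<tau> ^^ Suc n) (butlast u)) < length (\<tau> a) + s + length W"
  proof -
    have "(\<tau> ^^ n) (butlast u) @ (\<tau> ^^ n) [last u] = a @ v @ b"
      using u(1,3) power_append[of n "butlast u" "[last u]"] by simp
    also have "\<dots> = a @ (butlast v @ [last v]) @ b" using v(3) by simp
    finally have eq: "(\<tau> ^^ n) (butlast u) @ (\<tau> ^^ n) [last u] = (a @ butlast v) @ ([last v] @ b)"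
      by simp
    have "length v > 0" using v(3) by simp
    then have "length ((\<tau> ^^ n) (butlast u)) \<le> length (a @ butlast v)"
      using u(2,6) unfolding length_append length_butlast by linarith
    then obtain c where "a @ butlast v = (\<tau> ^^ n) (butlast u) @ c"
      using append_eq_append_le[OF eq] by blast
    then have "length ((\<tau> ^^ Suc n) (butlast u)) \<le> length (\<tau> (a @ butlast v))"
      using mono[of "(\<tau> ^^ n) (butlast u)" c] by simp
    then show ?thesis using v(5) by (simp add: substitution_append[OF subst])
  qed
  moreover have "(\<tau> ^^ Suc n) u = (\<tau> a @ p) @ W @ (t @ \<tau> b)"
    using u(1) v(1) by (simp add: substitution_append[OF subst])
  moreover have "length (\<tau> a @ p) = length (\<tau> a) + s" using v(2) by simp
  ultimately show ?thesis unfolding a reps_def using u(3,4) by blast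
qed

text \<open>The absolute position of \<open>W\<close> in \<open>\<tau> U\<close> fixes a minimal
  cover, whose end letters are those whose images meet the two ends of \<open>W\<close>. Thus
  composing covers loses no information.\<close>

lemma reps_determined:
  assumes v: "(v, s) \<in> reps \<tau> W" and v': "(v', s') \<in> reps \<tau> W"
    and u: "U = a @ v @ b" and u': "U = a' @ v' @ b'"
    and len: "length (\<tau> a) + s = length (\<tau> a') + s'"
  shows "a = a' \<and> v = v' \<and> s = s'"
proof -
  have cut: "length a' \<le> length a"
    if v: "(v, s) \<in> reps \<tau> W" and u: "U = a @ v @ b" and u': "U = a' @ v' @ b'"
      and len: "length (\<tau> a) + s = length (\<tau> a') + s'" for v s a b v' s' a' b'
  proof (rule ccontr)
    assume *: "\<not> length a' \<le> length a"
    have "v \<noteq> []" and s: "s < length (\<tau> [hd v])" using v by (auto simp: reps_def)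
    then have "(a @ [hd v]) @ (tl v @ b) = a' @ (v' @ b')" using u u' by simp
    moreover have "length (a @ [hd v]) \<le> length a'" using * by simp
    ultimately obtain c where "a' = (a @ [hd v]) @ c" using append_eq_append_le by blast
    then have "length (\<tau> a') = length (\<tau> a) + length (\<tau> [hd v]) + length (\<tau> c)"
      by (simp add: substitution_append[OF subst] substitution_Cons[OF subst, of "hd v" c])
    then show False using len s by simp
  qed
  have "length a = length a'"
    using cut[OF v u u' len] cut[OF v' u' u len[symmetric]] by simp
  then have a: "a = a'" and eq: "v @ b = v' @ b'" using u u' by auto
  then have s: "s = s'" using len by simp
  have last: "length v' \<le> length v"
    if v: "(v, s) \<in> reps \<tau> W" and v': "(v', s) \<in> reps \<tau> W" and eq: "v @ b = v' @ b'"
    for v b v' b'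
  proof (rule ccontr)
    assume *: "\<not> length v' \<le> length v"
    have "v' \<noteq> []" and l: "length (\<tau> (butlast v')) < s + length W" using v' by (auto simp: reps_def)
    then have "v @ b = butlast v' @ ([last v'] @ b')" using eq by simp
    moreover have "length v \<le> length (butlast v')" using * by simp
    ultimately obtain c where "butlast v' = v @ c" using append_eq_append_le by blast
    then have "length (\<tau> v) \<le> length (\<tau> (butlast v'))" by (simp add: substitution_append[OF subst])
    moreover have "s + length W \<le> length (\<tau> v)" using v by (auto simp: reps_def)
    ultimately show False using l by simp
  qed
  have "length v = length v'"
    using last[OF v v'[folded s] eq] last[OF v'[folded s] v eq[symmetric]] by simp
  then show ?thesis using a eq s by auto
qed

text \<open>Each desubstitution at least doubles the count, by \<open>two_reps\<close>. The length
  hypothesis ranges over all words whose images contain \<open>W\<close>, and not over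
  \<open>W\<close> alone, so that the covers of \<open>W\<close> inherit it in the
  induction.\<close>

lemma many_reps:
  assumes no_sync: "\<And>w1 w2. \<not> synchronizing w1 w2"
    and "W \<in> L" "\<And>k v. k \<le> n \<Longrightarrow> v \<in> L \<Longrightarrow> sublist W ((\<tau> ^^ k) v) \<Longrightarrow> max_len 1 \<le> length v"
  shows "2 ^ n \<le> card (reps (\<tau> ^^ n) W)"
  using assms(2,3)
proof (induction n arbitrary: W)
  case 0
  then have W: "max_len 1 \<le> length W" using 0(2)[of 0 W] by simp
  then have "W \<noteq> []" using max_len_pos[of 1] by auto
  then have "(W, 0) \<in> reps (\<tau> ^^ 0) W" using 0(1) by (auto simp: reps_def)
  moreover have "finite (reps (\<tau> ^^ 0) W)" by (rule finite_reps[OF power power_nonerasing])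
  ultimately have "card (reps (\<tau> ^^ 0) W) > 0" by (auto simp only: card_gt_0_iff)
  then show ?case by (simp only: power_0)
next
  case (Suc n)
  have fin: "finite (reps (\<tau> ^^ m) w)" for m w by (rule finite_reps[OF power power_nonerasing])
  have fin1: "finite (reps \<tau> w)" for w using fin[of 1] by simp
  \<comment> \<open>\<open>S\<close> consists of two-stage covers: one of \<open>W\<close> by
    \<open>\<tau>\<close>, then one of the covering word by \<open>\<tau> ^^ n\<close>. The map
    \<open>g\<close> composes the stages and is injective by \<open>reps_determined\<close>.\<close>
  define S where "S = (SIGMA x:reps \<tau> W. reps (\<tau> ^^ n) (fst x))"
  define g where "g = (\<lambda>((v :: 'a list, s), (u :: 'a list, r)). (u, length (\<tau> (take r ((\<tau> ^^ n) u))) + s))"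
  have IH: "2 ^ n \<le> card (reps (\<tau> ^^ n) v)" if "(v, s) \<in> reps \<tau> W" for v s
  proof (rule Suc.IH)
    show "v \<in> L" using that by (auto simp: reps_def)
    fix k v' assume *: "k \<le> n" "v' \<in> L" "sublist v ((\<tau> ^^ k) v')"
    have "sublist W (\<tau> v)" using that by (auto simp: reps_def)
    also have "sublist (\<tau> v) ((\<tau> ^^ Suc k) v')" using substitution_sublist[OF subst *(3)] by simp
    finally show "max_len 1 \<le> length v'" using Suc.prems(2)[of "Suc k" v'] *(1,2) by simp
  qed
  obtain x y where xy: "x \<in> reps \<tau> W" "y \<in> reps \<tau> W" "x \<noteq> y"
    using two_reps[OF no_sync Suc.prems(1)] Suc.prems(2)[of 0 W] Suc.prems(1) by auto
  have "2 ^ Suc n \<le> card {x, y} * 2 ^ n" using xy(3) by simp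
  also have "\<dots> \<le> card (reps \<tau> W) * 2 ^ n"
    using xy by (intro mult_le_mono1 card_mono fin1) simp
  also have "\<dots> = (\<Sum>x\<in>reps \<tau> W. 2 ^ n)" by simp
  also have "\<dots> \<le> (\<Sum>x\<in>reps \<tau> W. card (reps (\<tau> ^^ n) (fst x)))"
    by (intro sum_mono) (use IH in \<open>metis prod.collapse\<close>)
  also have "\<dots> = card S" unfolding S_def using fin fin1 by simp
  also have "\<dots> = card (g ` S)"
  proof (rule card_image[symmetric], rule inj_onI)
    fix x y assume xS: "x \<in> S" and yS: "y \<in> S" and gxy: "g x = g y"
    obtain v s u r where x: "x = ((v, s), (u, r))" by (metis surj_pair)
    obtain v' s' u' r' where y: "y = ((v', s'), (u', r'))" by (metis surj_pair)
    have vs: "(v, s) \<in> reps \<tau> W" "(v', s') \<in> reps \<tau> W" using xS yS x y by (auto simp: S_def)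
    obtain a b where a: "(\<tau> ^^ n) u = a @ v @ b" "length a = r"
      using xS x by (auto simp: S_def reps_def)
    obtain a' b' where a': "(\<tau> ^^ n) u' = a' @ v' @ b'" "length a' = r'"
      using yS y by (auto simp: S_def reps_def)
    have u: "u = u'" and "length (\<tau> (take r ((\<tau> ^^ n) u))) + s = length (\<tau> (take r' ((\<tau> ^^ n) u'))) + s'"
      using gxy x y by (auto simp: g_def)
    moreover have "take r ((\<tau> ^^ n) u) = a" using a by simp
    moreover have "take r' ((\<tau> ^^ n) u') = a'" using a' by simp
    ultimately have "length (\<tau> a) + s = length (\<tau> a') + s'" by simp
    from reps_determined[OF vs a(1) _ this] a' a(2) u show "x = y" by (auto simp: x y)
  qed
  also have "\<dots> \<le> card (reps (\<tau> ^^ Suc n) W)"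
  proof (rule card_mono[OF fin])
    show "g ` S \<subseteq> reps (\<tau> ^^ Suc n) W"
    proof
      fix z assume "z \<in> g ` S"
      then obtain x where x: "x \<in> S" "z = g x" by blast
      obtain v s u r where "x = ((v, s), (u, r))" by (metis surj_pair)
      then show "z \<in> reps (\<tau> ^^ Suc n) W"
        using x reps_compose[of v s W u r n] by (simp add: S_def g_def del: funpow.simps)
    qed
  qed
  finally show ?case .
qed

text \<open>Two covers of \<open>W\<close> by the same word at different offsets make their difference a period of \<open>W\<close>,
  so by the absence of high powers the offsets for a fixed word are far apart.\<close>

lemma few_reps:
  "\<exists>K. \<forall>n. \<forall>W\<in>L. length W = max_len 1 * max_len n \<longrightarrow> card (reps (\<tau> ^^ n) W) \<le> K"
proof -
  obtain C where C: "C > 0" "\<And>n a. max_len n \<le> C * length ((\<tau> ^^ n) [a])"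
    using distortion by blast
  obtain K where K: "K > 0" "\<And>W d. W \<in> L \<Longrightarrow> d > 0 \<Longrightarrow>
      (\<And>i. i + d < length W \<Longrightarrow> W ! i = W ! (i + d)) \<Longrightarrow> length W < K * d"
    using power_bound by blast
  \<comment> \<open>\<open>B\<close> bounds the number of letters of a minimal cover: if
    \<open>m\<close> is the least length of an image, then
    \<open>m * (length v - 1) < (1 + max_len 1) * max_len n\<close>, and
    \<open>max_len n \<le> C * m\<close>.\<close>
  define B where "B = C * (1 + max_len 1) + 1"
  define T where "T = {v :: 'a list. set v \<subseteq> UNIV \<and> length v \<le> B} \<times> {..<K}"
  have main: "card (reps (\<tau> ^^ n) W) \<le> card T"
    if W: "W \<in> L" and lenW: "length W = max_len 1 * max_len n" for n W
  proof (rule card_inj_on_le)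
    let ?M = "max_len n" and ?R = "reps (\<tau> ^^ n) W"
    \<comment> \<open>The offsets below \<open>?M\<close> are sorted into \<open>K\<close> classes.
      Two offsets of one class differ by some \<open>d\<close> with \<open>K * d < ?M\<close>; for
      the same \<open>v\<close> and \<open>d > 0\<close> this would be a period of \<open>W\<close>,
      giving \<open>?M \<le> length W < K * d\<close>.\<close>
    define g where "g = (\<lambda>(v :: 'a list, s). (v, s * K div ?M))"
    have M: "?M > 0" by (rule max_len_pos)
    have sM: "s < ?M" if "(v, s) \<in> ?R" for v s
      using that le_max_len[of n "hd v"] by (auto simp: reps_def)
    show "finite T"
      unfolding T_def by (intro finite_cartesian_product finite_lists_length_le finite_lessThan finite)
    show "g ` ?R \<subseteq> T"
    proof
      fix z assume "z \<in> g ` ?R"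
      then obtain v s where vs: "(v, s) \<in> ?R" "z = (v, s * K div ?M)" by (auto simp: g_def)
      have "s * K < ?M * K" using sM[OF vs(1)] K(1) by simp
      then have "s * K div ?M < K" using M by (simp add: less_mult_imp_div_less mult.commute)
      moreover have "length v \<le> B"
      proof -
        obtain a where a: "\<And>b. length ((\<tau> ^^ n) [a]) \<le> length ((\<tau> ^^ n) [b])"
          using ex_has_least_nat[of "\<lambda>_. True" undefined "\<lambda>a. length ((\<tau> ^^ n) [a])"] by auto
        let ?m = "length ((\<tau> ^^ n) [a])"
        have m: "?m > 0" using power_nonerasing by simp
        have "?m * (length v - 1) < ?M + length W"
          by (rule reps_length_le[OF vs(1) power a le_max_len])
        also have "\<dots> = (1 + max_len 1) * ?M" using lenW by simp
        also have "\<dots> \<le> (1 + max_len 1) * (C * ?m)" by (intro mult_le_mono2 C(2))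
        also have "\<dots> = ?m * (C * (1 + max_len 1))" by (simp add: algebra_simps)
        finally have "length v - 1 < C * (1 + max_len 1)" using m by simp
        then show ?thesis by (simp add: B_def)
      qed
      ultimately show "z \<in> T" using vs(2) by (simp add: T_def)
    qed
    have key: "s = s'" if s: "(v, s) \<in> ?R" "(v, s') \<in> ?R" "s * K div ?M = s' * K div ?M" "s \<le> s'" for v s s'
    proof (rule ccontr)
      assume "s \<noteq> s'"
      then have d: "s' - s > 0" using s(4) by simp
      obtain p t where p: "(\<tau> ^^ n) v = p @ W @ t" "length p = s" using s(1) by (auto simp: reps_def)
      obtain p' t' where p': "(\<tau> ^^ n) v = p' @ W @ t'" "length p' = s'" using s(2) by (auto simp: reps_def)
      have W1: "W ! i = (\<tau> ^^ n) v ! (s + i)" if "i < length W" for i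
        using p that by (simp add: nth_append)
      have W2: "W ! i = (\<tau> ^^ n) v ! (s' + i)" if "i < length W" for i
        using p' that by (simp add: nth_append)
      have "length W < K * (s' - s)"
      proof (rule K(2)[OF W d])
        fix i assume i: "i + (s' - s) < length W"
        then have "W ! (i + (s' - s)) = (\<tau> ^^ n) v ! (s + (i + (s' - s)))" by (rule W1)
        also have "s + (i + (s' - s)) = s' + i" using s(4) by simp
        finally show "W ! i = W ! (i + (s' - s))" using W2[of i] i by simp
      qed
      moreover have "?M \<le> length W" using lenW max_len_pos[of 1] by simp
      moreover have "K * (s' - s) < ?M"
      proof -
        define q where "q = s * K div ?M"
        have "?M * q \<le> s * K" unfolding q_def by simp
        moreover have "s' * K < ?M * q + ?M"
          using s(3) M div_mult_mod_eq[of "s' * K" ?M] mod_less_divisor[OF M, of "s' * K"]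
          unfolding q_def by (metis add.commute mult.commute nat_add_left_cancel_less)
        ultimately have "s' * K - s * K < ?M" using mult_le_mono1[OF s(4), of K] by linarith
        then show ?thesis by (simp add: diff_mult_distrib2 mult.commute)
      qed
      ultimately show False by simp
    qed
    show "inj_on g ?R"
    proof (rule inj_onI)
      fix x y assume xy: "x \<in> ?R" "y \<in> ?R" "g x = g y"
      obtain v s v' s' where eq: "x = (v, s)" "y = (v', s')" by (metis surj_pair)
      then have *: "v' = v" "s * K div ?M = s' * K div ?M" using xy(3) by (auto simp: g_def)
      then have R: "(v, s) \<in> ?R" "(v, s') \<in> ?R" using xy eq by auto
      have "s = s'"
      proof (cases "s \<le> s'")
        case True
        then show ?thesis by (rule key[OF R *(2)])
      next
        case False
        then have "s' \<le> s" by simp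
        then show ?thesis by (rule key[OF R(2,1) *(2)[symmetric], symmetric])
      qed
      then show "x = y" using eq *(1) by simp
    qed
  qed
  show ?thesis by (intro exI[of _ "card T"] allI ballI impI main)
qed

text \<open>The length \<open>max_len 1 * max_len K\<close> suits both estimates: it is a bounded
  multiple of \<open>max_len K\<close>, as the upper bound requires, and it forces every word
  covering \<open>W\<close> at a stage \<open>k \<le> K\<close> to have at least
  \<open>max_len 1\<close> letters. Choosing \<open>K\<close> stages gives
  \<open>2 ^ K \<le> K\<close>, which is absurd.\<close>

lemma synchronizing_word: "\<exists>w1 w2. synchronizing w1 w2"
proof (rule ccontr)
  assume "\<nexists>w1 w2. synchronizing w1 w2"
  then have no_sync: "\<And>w1 w2. \<not> synchronizing w1 w2" by blast
  obtain K where K: "\<And>n W. W \<in> L \<Longrightarrow> length W = max_len 1 * max_len n \<Longrightarrow> card (reps (\<tau> ^^ n) W) \<le> K"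
    using few_reps by blast
  obtain W where W: "W \<in> L" "length W = max_len 1 * max_len K" using long_power_word by blast
  have "2 ^ K \<le> card (reps (\<tau> ^^ K) W)"
  proof (rule many_reps[OF no_sync W(1)])
    fix k v assume k: "k \<le> K" "v \<in> L" "sublist W ((\<tau> ^^ k) v)"
    have "max_len 1 * max_len K \<le> length ((\<tau> ^^ k) v)" using sublist_length_le[OF k(3)] W(2) by simp
    also have "\<dots> \<le> max_len k * length v" by (rule power_le_max_len)
    also have "\<dots> \<le> max_len K * length v" using max_len_mono[OF k(1)] by simp
    finally show "max_len 1 \<le> length v" using max_len_pos[of K] by simp
  qed
  then have "2 ^ K \<le> K" using K[OF W] by simp
  then show False using less_exp[of K] by simp
qed

end

section \<open>Dill maps\<close>

lemma funpow_shift: "(shift ^^ n) x = (\<lambda>i. x (i + n))"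
  by (induction n arbitrary: x) (auto simp: shift_def)

text \<open>Basic open sets of the product constrain finitely many coordinates, so the sets given by
  a prefix form a base.\<close>

lemma openin_full_shift:
  "openin full_shift S \<longleftrightarrow> (\<forall>x\<in>S. \<exists>n. \<forall>y. (\<forall>i<n. y i = x i) \<longrightarrow> y \<in> S)"
proof
  assume "openin full_shift S"
  then have S: "\<exists>U. finite {i. U i \<noteq> UNIV} \<and> (\<forall>i. x i \<in> U i) \<and> Pi\<^sub>E UNIV U \<subseteq> S" if "x \<in> S" for x
    using that unfolding full_shift_def openin_product_topology_alt by (force simp: PiE_iff)
  show "\<forall>x\<in>S. \<exists>n. \<forall>y. (\<forall>i<n. y i = x i) \<longrightarrow> y \<in> S"
  proof
    fix x assume "x \<in> S"
    then obtain U where U: "finite {i. U i \<noteq> UNIV}" "\<And>i. x i \<in> U i" "Pi\<^sub>E UNIV U \<subseteq> S"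
      using S by blast
    obtain n where n: "{i. U i \<noteq> UNIV} \<subseteq> {..<n}" using U(1) finite_nat_iff_bounded by blast
    have "y \<in> S" if y: "\<forall>i<n. y i = x i" for y
    proof -
      have "y i \<in> U i" for i
        using n U(2)[of i] y by (cases "U i = UNIV") (auto simp: subset_iff)
      then show ?thesis using U(3) by (auto simp: PiE_iff)
    qed
    then show "\<exists>n. \<forall>y. (\<forall>i<n. y i = x i) \<longrightarrow> y \<in> S" by blast
  qed
next
  assume S: "\<forall>x\<in>S. \<exists>n. \<forall>y. (\<forall>i<n. y i = x i) \<longrightarrow> y \<in> S"
  show "openin full_shift S"
    unfolding full_shift_def openin_product_topology_alt
  proof
    fix x assume "x \<in> S"
    then obtain n where n: "\<And>y. (\<forall>i<n. y i = x i) \<Longrightarrow> y \<in> S" using S by blast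
    define U where "U i = (if i < n then {x i} else UNIV)" for i
    have "{i. U i \<noteq> UNIV} \<subseteq> {..<n}" by (auto simp: U_def)
    then have "finite {i. U i \<noteq> UNIV}" using finite_subset by blast
    moreover have "y \<in> S" if "y \<in> Pi\<^sub>E UNIV U" for y
    proof (rule n, intro allI impI)
      fix i assume "i < n"
      moreover have "y i \<in> U i" using that by (auto simp: PiE_iff)
      ultimately show "y i = x i" by (simp add: U_def)
    qed
    moreover have "x \<in> Pi\<^sub>E UNIV U" by (auto simp: U_def PiE_iff)
    ultimately show "\<exists>U. finite {i \<in> UNIV. U i \<noteq> topspace (discrete_topology UNIV)} \<and>
        (\<forall>i\<in>UNIV. openin (discrete_topology UNIV) (U i)) \<and> x \<in> Pi\<^sub>E UNIV U \<and> Pi\<^sub>E UNIV U \<subseteq> S"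
      by (intro exI[of _ U]) auto
  qed
qed

lemma topspace_full_shift [simp]: "topspace full_shift = UNIV"
  by (simp add: full_shift_def)

lemma closedin_full_shift:
  "closedin full_shift S \<longleftrightarrow> (\<forall>x. (\<forall>n. \<exists>y\<in>S. \<forall>i<n. y i = x i) \<longrightarrow> x \<in> S)"
proof -
  have "closedin full_shift S \<longleftrightarrow> (\<forall>x. x \<notin> S \<longrightarrow> (\<exists>n. \<forall>y. (\<forall>i<n. y i = x i) \<longrightarrow> y \<notin> S))"
    unfolding closedin_def openin_full_shift by (simp add: Ball_def)
  then show ?thesis by metis
qed

lemma continuous_map_discrete_iff:
  "continuous_map (subtopology full_shift X) (discrete_topology UNIV) f \<longleftrightarrow>
    (\<forall>x\<in>X. \<exists>n. \<forall>y\<in>X. (\<forall>i<n. y i = x i) \<longrightarrow> f y = f x)" (is "?l \<longleftrightarrow> ?r")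
proof
  assume l: ?l
  show ?r
  proof
    fix x assume x: "x \<in> X"
    have "openin (subtopology full_shift X) {y \<in> topspace (subtopology full_shift X). f y \<in> {f x}}"
      using l unfolding continuous_map_def by (metis openin_discrete_topology subset_UNIV)
    then obtain T where T: "openin full_shift T" "{y \<in> X. f y = f x} = T \<inter> X"
      by (auto simp: openin_subtopology)
    then have "x \<in> T" using x by blast
    then obtain n where "\<And>y. (\<forall>i<n. y i = x i) \<Longrightarrow> y \<in> T" using T(1) openin_full_shift by blast
    then show "\<exists>n. \<forall>y\<in>X. (\<forall>i<n. y i = x i) \<longrightarrow> f y = f x" using T(2) by blast
  qed
next
  assume r: ?r
  show ?l
    unfolding continuous_map_def
  proof (intro conjI allI impI)
    fix U
    define T where "T = {x. \<exists>n. \<forall>y\<in>X. (\<forall>i<n. y i = x i) \<longrightarrow> f y \<in> U}"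
    have "openin full_shift T"
      unfolding openin_full_shift
    proof
      fix x assume "x \<in> T"
      then obtain n where n: "\<forall>y\<in>X. (\<forall>i<n. y i = x i) \<longrightarrow> f y \<in> U" by (auto simp: T_def)
      have "z \<in> T" if "\<forall>i<n. z i = x i" for z
        unfolding T_def using n that by (intro CollectI exI[of _ n]) simp
      then show "\<exists>n. \<forall>z. (\<forall>i<n. z i = x i) \<longrightarrow> z \<in> T" by blast
    qed
    moreover have "{x \<in> topspace (subtopology full_shift X). f x \<in> U} = T \<inter> X"
    proof (intro equalityI subsetI)
      fix x assume "x \<in> {x \<in> topspace (subtopology full_shift X). f x \<in> U}"
      then have x: "x \<in> X" "f x \<in> U" by auto
      then obtain n where n: "\<forall>y\<in>X. (\<forall>i<n. y i = x i) \<longrightarrow> f y = f x" using r by blast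
      have "x \<in> T" unfolding T_def using n x(2) by (intro CollectI exI[of _ n]) simp
      then show "x \<in> T \<inter> X" using x by blast
    qed (auto simp: T_def)
    ultimately show "openin (subtopology full_shift X)
        {x \<in> topspace (subtopology full_shift X). f x \<in> U}"
      by (auto simp: openin_subtopology)
  qed auto
qed

lemma continuous_map_full_shift_iff:
  "continuous_map (subtopology full_shift X) (subtopology full_shift Y) f \<longleftrightarrow>
    f ` X \<subseteq> Y \<and> (\<forall>x\<in>X. \<forall>m. \<exists>n. \<forall>y\<in>X. (\<forall>i<n. y i = x i) \<longrightarrow> f y m = f x m)"
proof -
  have "continuous_map (subtopology full_shift X) full_shift f \<longleftrightarrow>
      (\<forall>m. continuous_map (subtopology full_shift X) (discrete_topology UNIV) (\<lambda>x. f x m))"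
    unfolding full_shift_def[where 'a = 'b] by (rule continuous_map_componentwise_UNIV)
  then show ?thesis
    unfolding continuous_map_in_subtopology continuous_map_discrete_iff by auto
qed

lemma continuous_map_full_shift_prefix:
  assumes "continuous_map (subtopology full_shift X) (subtopology full_shift Y) f" "x \<in> X"
  shows "\<exists>n. \<forall>y\<in>X. (\<forall>i<n. y i = x i) \<longrightarrow> (\<forall>j<m. f y j = f x j)"
proof (induction m)
  case (Suc m)
  then obtain n where n: "\<forall>y\<in>X. (\<forall>i<n. y i = x i) \<longrightarrow> (\<forall>j<m. f y j = f x j)" by blast
  obtain n' where n': "\<forall>y\<in>X. (\<forall>i<n'. y i = x i) \<longrightarrow> f y m = f x m"
    using assms unfolding continuous_map_full_shift_iff by blast
  show ?case
    using n n' by (intro exI[of _ "max n n'"]) (auto simp: less_Suc_eq)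
qed simp

lemma subshift_funpow: "subshift X \<Longrightarrow> x \<in> X \<Longrightarrow> (shift ^^ n) x \<in> X"
  by (induction n) (auto simp: subshift_def)

lemma funpow_shift_add: "(shift ^^ m) ((shift ^^ n) x) = (shift ^^ (n + m)) x"
  by (simp add: funpow_shift add_ac)

section \<open>Infinite concatenations, implementations and composition of dill maps\<close>

lemma concat_upto_Suc: "concat_upto w (Suc n) = concat_upto w n @ w n"
  by (simp add: concat_upto_def)

lemma concat_filterlim:
  assumes "\<And>N. \<exists>n. N \<le> length (concat_upto w n)"
  shows "filterlim (\<lambda>n. length (concat_upto w n)) at_top sequentially"
  unfolding filterlim_at_top
proof
  fix N
  obtain n where "N \<le> length (concat_upto w n)" using assms by blast
  then have "N \<le> length (concat_upto w m)" if "n \<le> m" for m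
    using prefix_length_le[OF concat_upto_prefix[OF that, of w]] by simp
  then show "\<forall>\<^sub>F n in sequentially. N \<le> length (concat_upto w n)"
    by (auto simp: eventually_sequentially)
qed

lemma has_inf_concatI:
  assumes "\<And>n i. i < length (concat_upto w n) \<Longrightarrow> concat_upto w n ! i = x i"
    and "\<And>N. \<exists>n. N \<le> length (concat_upto w n)"
  shows "has_inf_concat w x"
  unfolding has_inf_concat_def
  using concat_filterlim[OF assms(2)] assms(1) by (auto intro!: nth_equalityI)

lemma has_inf_concat_unbounded:
  assumes "has_inf_concat w x"
  shows "\<exists>n. N \<le> length (concat_upto w n)"
  using assms unfolding has_inf_concat_def filterlim_at_top
  by (metis eventually_sequentially order_refl)

lemma has_inf_concat_shift:
  assumes "has_inf_concat w x"
  shows "has_inf_concat (\<lambda>i. w (Suc i)) ((shift ^^ length (w 0)) x)"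
proof (rule has_inf_concatI)
  have Suc: "concat_upto w (Suc n) = w 0 @ concat_upto (\<lambda>i. w (Suc i)) n" for n
    unfolding concat_upto_def upt_conv_Cons[OF zero_less_Suc] map_Suc_upt[symmetric] by (simp add: o_def)
  show "concat_upto (\<lambda>i. w (Suc i)) n ! i = (shift ^^ length (w 0)) x i"
    if "i < length (concat_upto (\<lambda>i. w (Suc i)) n)" for n i
    using has_inf_concat_nth[OF assms, of "i + length (w 0)" "Suc n"] that
    by (simp add: Suc funpow_shift nth_append)
  show "\<exists>n. N \<le> length (concat_upto (\<lambda>i. w (Suc i)) n)" for N
  proof -
    obtain n where n: "N + length (w 0) \<le> length (concat_upto w n)"
      using has_inf_concat_unbounded[OF assms] by blast
    also have "\<dots> \<le> length (concat_upto w (Suc n))" by (simp add: concat_upto_Suc)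
    finally show ?thesis by (auto simp: Suc)
  qed
qed

lemma implementation_shift:
  assumes "implementation X \<Phi> \<phi>" "subshift X" "x \<in> X"
  shows "\<Phi> (shift x) = (shift ^^ length (\<phi> x)) (\<Phi> x)"
proof -
  have sx: "shift x \<in> X" using assms(2,3) by (auto simp: subshift_def)
  have "has_inf_concat (\<lambda>i. \<phi> ((shift ^^ i) x)) (\<Phi> x)"
    using assms(1,3) by (simp add: implementation_def)
  from has_inf_concat_shift[OF this]
  have "has_inf_concat (\<lambda>i. \<phi> ((shift ^^ i) (shift x))) ((shift ^^ length (\<phi> x)) (\<Phi> x))"
    by (simp only: funpow_swap1[symmetric] funpow.simps o_apply id_apply)
  moreover have "has_inf_concat (\<lambda>i. \<phi> ((shift ^^ i) (shift x))) (\<Phi> (shift x))"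
    using assms(1) sx by (simp add: implementation_def)
  ultimately show ?thesis using has_inf_concat_unique by blast
qed

text \<open>The shift function is \<open>length (\<phi> x)\<close>, and a coordinate of the image is
  fixed by finitely many words. Were all words along an orbit empty, the concatenation could not be
  infinite.\<close>

lemma implementation_dill_map:
  assumes impl: "implementation X \<Phi> \<phi>" and X: "subshift X" and Y: "subshift Y"
    and into: "\<And>x. x \<in> X \<Longrightarrow> \<Phi> x \<in> Y"
  shows "dill_map X Y \<Phi>"
  unfolding dill_map_def
proof (intro conjI X Y exI[of _ "\<lambda>x. length (\<phi> x)"] ballI)
  have cont: "\<exists>n. \<forall>y\<in>X. (\<forall>i<n. y i = x i) \<longrightarrow> \<phi> y = \<phi> x" if "x \<in> X" for x
    using impl that unfolding implementation_def continuous_map_discrete_iff by blast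
  have cat: "has_inf_concat (\<lambda>i. \<phi> ((shift ^^ i) x)) (\<Phi> x)" if "x \<in> X" for x
    using impl that by (simp add: implementation_def)
  have prefix: "\<exists>n. \<forall>y\<in>X. (\<forall>i<n. y i = x i) \<longrightarrow>
      concat_upto (\<lambda>i. \<phi> ((shift ^^ i) y)) k = concat_upto (\<lambda>i. \<phi> ((shift ^^ i) x)) k" if x: "x \<in> X" for x k
  proof (induction k)
    case 0 show ?case by (simp add: concat_upto_def)
  next
    case (Suc k)
    then obtain n where n: "\<forall>y\<in>X. (\<forall>i<n. y i = x i) \<longrightarrow>
      concat_upto (\<lambda>i. \<phi> ((shift ^^ i) y)) k = concat_upto (\<lambda>i. \<phi> ((shift ^^ i) x)) k" by blast
    from cont[OF subshift_funpow[OF X x]] obtain m where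
      m: "\<forall>y\<in>X. (\<forall>i<m. y i = (shift ^^ k) x i) \<longrightarrow> \<phi> y = \<phi> ((shift ^^ k) x)" ..
    have "concat_upto (\<lambda>i. \<phi> ((shift ^^ i) y)) (Suc k) = concat_upto (\<lambda>i. \<phi> ((shift ^^ i) x)) (Suc k)"
      if y: "y \<in> X" "\<forall>i<max n (m + k). y i = x i" for y
    proof -
      have "\<phi> ((shift ^^ k) y) = \<phi> ((shift ^^ k) x)"
        by (rule m[rule_format, OF subshift_funpow[OF X y(1)]]) (use y(2) in \<open>simp add: funpow_shift\<close>)
      then show ?thesis using n y by (simp add: concat_upto_Suc)
    qed
    then show ?case by blast
  qed
  show "continuous_map (subtopology full_shift X) (subtopology full_shift Y) \<Phi>"
    unfolding continuous_map_full_shift_iff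
  proof (intro conjI ballI allI)
    show "\<Phi> ` X \<subseteq> Y" using into by blast
    fix x m assume x: "x \<in> X"
    obtain k where k: "Suc m \<le> length (concat_upto (\<lambda>i. \<phi> ((shift ^^ i) x)) k)"
      using has_inf_concat_unbounded[OF cat[OF x]] by blast
    from prefix[OF x, of k] obtain n where n: "\<forall>y\<in>X. (\<forall>i<n. y i = x i) \<longrightarrow>
      concat_upto (\<lambda>i. \<phi> ((shift ^^ i) y)) k = concat_upto (\<lambda>i. \<phi> ((shift ^^ i) x)) k" ..
    have "\<Phi> y m = \<Phi> x m" if y: "y \<in> X" "\<forall>i<n. y i = x i" for y
      using has_inf_concat_nth[OF cat[OF x], of m k] has_inf_concat_nth[OF cat[OF y(1)], of m k] k n[rule_format, OF y(1)] y(2)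
      by (simp add: Suc_le_eq)
    then show "\<exists>n. \<forall>y\<in>X. (\<forall>i<n. y i = x i) \<longrightarrow> \<Phi> y m = \<Phi> x m" by blast
  qed
  show "continuous_map (subtopology full_shift X) (discrete_topology UNIV) (\<lambda>x. length (\<phi> x))"
    unfolding continuous_map_discrete_iff using cont by metis
  show "\<Phi> (shift x) = (shift ^^ length (\<phi> x)) (\<Phi> x)" if "x \<in> X" for x
    by (rule implementation_shift[OF impl X that])
  show "\<exists>n. 0 < length (\<phi> ((shift ^^ n) x))" if "x \<in> X" for x
  proof (rule ccontr)
    assume "\<nexists>n. 0 < length (\<phi> ((shift ^^ n) x))"
    then have "concat_upto (\<lambda>i. \<phi> ((shift ^^ i) x)) n = []" for n by (simp add: concat_upto_def)
    then show False using has_inf_concat_unbounded[OF cat[OF that], of 1] by simp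
  qed
qed

lemma dill_map_funpow:
  assumes "\<And>x. x \<in> X \<Longrightarrow> \<Phi> (shift x) = (shift ^^ s x) (\<Phi> x)" "subshift X" "x \<in> X"
  shows "\<Phi> ((shift ^^ n) x) = (shift ^^ (\<Sum>i<n. s ((shift ^^ i) x))) (\<Phi> x)"
proof (induction n)
  case (Suc n)
  then show ?case
    using assms(1)[OF subshift_funpow[OF assms(2,3)], of n] by (simp add: funpow_shift_add)
qed simp

text \<open>One shift of \<open>x\<close> moves \<open>\<Phi> x\<close> by \<open>s x\<close>
  places, so \<open>\<Psi>\<close> is moved by the sum of \<open>t\<close> over those places. This
  is positive somewhere because the steps of length \<open>s\<close> exhaust the orbit of
  \<open>\<Phi> x\<close>, including a place where \<open>t\<close> is positive.\<close>

lemma dill_map_comp: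
  assumes "dill_map X Y \<Phi>" "dill_map Y Z \<Psi>"
  shows "dill_map X Z (\<Psi> \<circ> \<Phi>)"
proof -
  obtain s where X: "subshift X" and Y: "subshift Y"
    and \<Phi>: "continuous_map (subtopology full_shift X) (subtopology full_shift Y) \<Phi>"
    and s: "continuous_map (subtopology full_shift X) (discrete_topology UNIV) s"
      "\<And>x. x \<in> X \<Longrightarrow> \<Phi> (shift x) = (shift ^^ s x) (\<Phi> x)"
      "\<And>x. x \<in> X \<Longrightarrow> \<exists>n. s ((shift ^^ n) x) > 0"
    using assms(1) unfolding dill_map_def by blast
  obtain t where Z: "subshift Z"
    and \<Psi>: "continuous_map (subtopology full_shift Y) (subtopology full_shift Z) \<Psi>"
    and t: "continuous_map (subtopology full_shift Y) (discrete_topology UNIV) t"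
      "\<And>x. x \<in> Y \<Longrightarrow> \<Psi> (shift x) = (shift ^^ t x) (\<Psi> x)"
      "\<And>x. x \<in> Y \<Longrightarrow> \<exists>n. t ((shift ^^ n) x) > 0"
    using assms(2) unfolding dill_map_def by blast
  have \<Phi>Y: "\<Phi> x \<in> Y" if "x \<in> X" for x using \<Phi> that unfolding continuous_map_full_shift_iff by blast
  define r where "r x = (\<Sum>i<s x. t ((shift ^^ i) (\<Phi> x)))" for x
  have r: "(\<Psi> \<circ> \<Phi>) (shift x) = (shift ^^ r x) ((\<Psi> \<circ> \<Phi>) x)" if "x \<in> X" for x
    using s(2)[OF that] dill_map_funpow[of Y \<Psi> t, OF t(2) Y \<Phi>Y[OF that]] by (simp add: r_def)
  have cont_r: "continuous_map (subtopology full_shift X) (discrete_topology UNIV) r"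
    unfolding continuous_map_discrete_iff
  proof
    fix x assume x: "x \<in> X"
    from s(1)[unfolded continuous_map_discrete_iff, rule_format, OF x]
    obtain n0 where n0: "\<forall>y\<in>X. (\<forall>i<n0. y i = x i) \<longrightarrow> s y = s x" ..
    have "\<exists>n. \<forall>y\<in>X. (\<forall>i<n. y i = x i) \<longrightarrow>
        (\<Sum>i<k. t ((shift ^^ i) (\<Phi> y))) = (\<Sum>i<k. t ((shift ^^ i) (\<Phi> x)))" for k
    proof (induction k)
      case (Suc k)
      then obtain n where n: "\<forall>y\<in>X. (\<forall>i<n. y i = x i) \<longrightarrow>
        (\<Sum>i<k. t ((shift ^^ i) (\<Phi> y))) = (\<Sum>i<k. t ((shift ^^ i) (\<Phi> x)))" ..
      from t(1)[unfolded continuous_map_discrete_iff, rule_format, OF subshift_funpow[OF Y \<Phi>Y[OF x], of k]]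
      obtain m where m: "\<forall>y\<in>Y. (\<forall>i<m. y i = (shift ^^ k) (\<Phi> x) i) \<longrightarrow> t y = t ((shift ^^ k) (\<Phi> x))" ..
      from continuous_map_full_shift_prefix[OF \<Phi> x, of "m + k"]
      obtain l where l: "\<forall>y\<in>X. (\<forall>i<l. y i = x i) \<longrightarrow> (\<forall>j<m + k. \<Phi> y j = \<Phi> x j)" ..
      have "t ((shift ^^ k) (\<Phi> y)) = t ((shift ^^ k) (\<Phi> x))" if "y \<in> X" "\<forall>i<l. y i = x i" for y
        by (rule m[rule_format, OF subshift_funpow[OF Y \<Phi>Y[OF that(1)]]]) (use l that in \<open>simp add: funpow_shift\<close>)
      then show ?case using n by (intro exI[of _ "max n l"]) auto
    qed simp
    from this[of "s x"] obtain n where n: "\<forall>y\<in>X. (\<forall>i<n. y i = x i) \<longrightarrow>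
        (\<Sum>i<s x. t ((shift ^^ i) (\<Phi> y))) = (\<Sum>i<s x. t ((shift ^^ i) (\<Phi> x)))" ..
    have "r y = r x" if "y \<in> X" "\<forall>i<max n n0. y i = x i" for y
      using n0 n that by (simp add: r_def)
    then show "\<exists>n. \<forall>y\<in>X. (\<forall>i<n. y i = x i) \<longrightarrow> r y = r x" by blast
  qed
  have pos: "\<exists>n. r ((shift ^^ n) x) > 0" if x: "x \<in> X" for x
  proof -
    define S where "S n = (\<Sum>i<n. s ((shift ^^ i) x))" for n
    have unbounded: "\<exists>n. N \<le> S n" for N
    proof (induction N)
      case (Suc N)
      then obtain n where n: "N \<le> S n" by blast
      obtain m where m: "s ((shift ^^ m) ((shift ^^ n) x)) > 0"
        using s(3)[OF subshift_funpow[OF X x]] by blast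
      have "S n \<le> S (n + m)" unfolding S_def by (rule sum_mono2) auto
      then have "Suc N \<le> S (Suc (n + m))" using n m by (simp add: S_def funpow_shift_add)
      then show ?case by blast
    qed (simp add: S_def)
    obtain i where i: "t ((shift ^^ i) (\<Phi> x)) > 0" using t(3)[OF \<Phi>Y[OF x]] by blast
    \<comment> \<open>The first \<open>n\<close> with \<open>S n > i\<close> singles out the step,
      number \<open>n - 1\<close>, during which place \<open>i\<close> of the orbit is
      passed.\<close>
    define n where "n = (LEAST n. Suc i \<le> S n)"
    have n: "Suc i \<le> S n" unfolding n_def using unbounded by (rule LeastI_ex)
    then obtain m where m: "n = Suc m" by (cases n) (auto simp: S_def)
    have "S m \<le> i" using not_less_Least[of m "\<lambda>n. Suc i \<le> S n"] m n_def by auto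
    moreover have "S n = S m + s ((shift ^^ m) x)" by (simp add: m S_def)
    ultimately have j: "i - S m < s ((shift ^^ m) x)" "(shift ^^ (i - S m)) (\<Phi> ((shift ^^ m) x)) = (shift ^^ i) (\<Phi> x)"
      using n dill_map_funpow[of X \<Phi> s, OF s(2) X x, of m] by (auto simp: S_def funpow_shift_add)
    have "t ((shift ^^ (i - S m)) (\<Phi> ((shift ^^ m) x))) \<le> r ((shift ^^ m) x)"
      unfolding r_def by (rule member_le_sum) (use j(1) in auto)
    then show ?thesis using i j(2) by (metis less_le_trans)
  qed
  have "continuous_map (subtopology full_shift X) (subtopology full_shift Z) (\<Psi> \<circ> \<Phi>)"
    by (rule continuous_map_compose[OF \<Phi> \<Psi>])
  then show ?thesis unfolding dill_map_def using X Z cont_r r pos by blast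
qed

lemma dill_map_id:
  assumes "subshift X"
  shows "dill_map X X id"
  unfolding dill_map_def
  by (intro conjI assms exI[of _ "\<lambda>_. 1"] ballI) (auto simp: continuous_map_id)

section \<open>Desubstitution\<close>

lemma map_upt_split: "i \<le> j \<Longrightarrow> j \<le> k \<Longrightarrow> map x [i..<k] = map x [i..<j] @ map x [j..<k]"
  by (metis le_add_diff_inverse map_append upt_add_eq_append)

lemma map_upt_shift: "map ((shift ^^ n) x) [i..<j] = map x [n + i..<n + j]"
  by (intro nth_equalityI) (auto simp: funpow_shift add_ac)

context aperiodic_primitive
begin

section \<open>Closedness and minimality of the subshift\<close>

lemma in_X_if_prefixes:
  assumes "\<And>N. \<exists>n\<ge>N. map x [0..<n] \<in> L"
  shows "x \<in> X"
  unfolding subst_subshift_iff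
proof (intro allI)
  fix i j
  obtain n where n: "n \<ge> max i j" "map x [0..<n] \<in> L" using assms by blast
  have "sublist (map x [i..<j]) (map x [0..<n])"
  proof (cases "i \<le> j")
    case True
    then have "map x [0..<n] = map x [0..<i] @ map x [i..<j] @ map x [j..<n]"
      using n(1) map_upt_split[of 0 i n x] map_upt_split[of i j n x] by simp
    then show ?thesis by (metis sublist_appendI)
  qed simp
  then show "map x [i..<j] \<in> L" using n(2) language_sublist by blast
qed

lemma subshift_X: "subshift X"
  unfolding subshift_def closedin_full_shift
proof (intro conjI allI impI image_subsetI)
  fix x assume x: "\<forall>n. \<exists>y\<in>X. \<forall>i<n. y i = x i"
  show "x \<in> X"
  proof (rule in_X_if_prefixes)
    fix N
    obtain y where y: "y \<in> X" "\<forall>i<N. y i = x i" using x by blast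
    then have "map x [0..<N] = map y [0..<N]" by simp
    also have "\<dots> \<in> L" using y(1) unfolding subst_subshift_iff by blast
    finally show "\<exists>n\<ge>N. map x [0..<n] \<in> L" by blast
  qed
next
  fix x assume x: "x \<in> X"
  have "map (shift x) [i..<j] = map x [1 + i..<1 + j]" for i j
    using map_upt_shift[of 1 x i j] by (simp del: upt_Suc)
  then show "shift x \<in> X" using x unfolding subst_subshift_iff by metis
qed

text \<open>Linear recurrence with the bound made uniform in the point and the position; it later
  limits how long the next cut can be delayed.\<close>

lemma occurs_boundedly:
  assumes "w \<in> L"
  shows "\<exists>B. \<forall>x\<in>X. \<forall>i. \<exists>j. i \<le> j \<and> j < i + B \<and> map x [j..<j + length w] = w"
proof -
  obtain K where K: "\<And>d w W. d > 0 \<Longrightarrow> w \<in> L \<Longrightarrow> W \<in> L \<Longrightarrow> length w \<le> d \<Longrightarrow>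
      K * d \<le> length W \<Longrightarrow> sublist w W"
    using linear_recurrence by blast
  define B where "B = K * Suc (length w)"
  have "\<exists>j. i \<le> j \<and> j < i + Suc B \<and> map x [j..<j + length w] = w" if x: "x \<in> X" for x i
  proof -
    have W: "map x [i..<i + B] \<in> L" using x unfolding subst_subshift_iff by blast
    have "sublist w (map x [i..<i + B])"
      by (rule K[OF _ assms W, of "Suc (length w)"]) (simp_all add: B_def)
    then obtain s t where st: "map x [i..<i + B] = s @ w @ t" by (auto simp: sublist_def)
    then have len: "B = length s + length w + length t"
      by (metis add.assoc add_diff_cancel_left' length_append length_map length_upt)
    have "map x [i + length s..<i + length s + length w] = w"
    proof (rule nth_equalityI)
      fix k assume "k < length (map x [i + length s..<i + length s + length w])"
      then have k: "k < length w" by simp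
      have "map x [i..<i + B] ! (length s + k) = x (i + length s + k)"
        using k len by (simp add: add.assoc)
      then show "map x [i + length s..<i + length s + length w] ! k = w ! k"
        using k by (simp add: st nth_append)
    qed simp
    then show ?thesis using len by (intro exI[of _ "i + length s"]) simp
  qed
  then show ?thesis by blast
qed

text \<open>Every prefix of \<open>x\<close> occurs in every point \<open>y\<close>, so shifts of
  \<open>y\<close> approximate \<open>x\<close>, and closedness puts \<open>x\<close> into
  \<open>Y\<close>.\<close>

lemma minimal_X: "minimal_subshift X"
  unfolding minimal_subshift_def
proof (intro conjI subshift_X allI impI)
  fix Y assume Y: "subshift Y \<and> Y \<subseteq> X"
  show "Y = {} \<or> Y = X"
  proof (cases "Y = {}")
    case False
    then obtain y where y: "y \<in> Y" by blast
    have "x \<in> Y" if x: "x \<in> X" for x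
    proof -
      have "\<exists>z\<in>Y. \<forall>i<n. z i = x i" for n
      proof -
        let ?w = "map x [0..<n]"
        have "?w \<in> L" using x unfolding subst_subshift_iff by blast
        moreover have "y \<in> X" using y Y by blast
        ultimately obtain j where j: "map y [j..<j + length ?w] = ?w"
          using occurs_boundedly by meson
        have "(shift ^^ j) y i = x i" if "i < n" for i
          using arg_cong[OF j, of "\<lambda>l. l ! i"] that by (simp add: funpow_shift add.commute)
        then show ?thesis using subshift_funpow[of Y y j] Y y by blast
      qed
      then show ?thesis using Y unfolding subshift_def closedin_full_shift by blast
    qed
    then show ?thesis using Y by blast
  qed simp
qed

section \<open>The action of \<open>\<tau>\<close> as a dill map\<close>

lemma concat_upto_action: "concat_upto (\<lambda>i. \<tau> [x i]) n = \<tau> (map x [0..<n])"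
  unfolding concat_upto_def using substitution_eq_concat[OF subst, of "map x [0..<n]"]
  by (simp add: o_def)

lemma length_le_image: "length u \<le> length (\<tau> u)"
  by (rule length_le_substitution[OF subst nonerasing])

lemma has_inf_concat_action: "has_inf_concat (\<lambda>i. \<tau> [x i]) (subst_action \<tau> x)"
  unfolding subst_action_def
  by (rule has_inf_concat_inf_concat, rule concat_filterlim)
    (metis concat_upto_action length_le_image length_map length_upt minus_nat.diff_0)

lemma action_prefix:
  "\<tau> (map x [0..<n]) = map (subst_action \<tau> x) [0..<length (\<tau> (map x [0..<n]))]"
  using has_inf_concat_action[of x] unfolding has_inf_concat_def concat_upto_action by blast

lemma action_segment:
  assumes "i \<le> j"
  shows "\<tau> (map x [i..<j]) =
    map (subst_action \<tau> x) [length (\<tau> (map x [0..<i]))..<length (\<tau> (map x [0..<j]))]"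
proof -
  let ?l = "\<lambda>k. length (\<tau> (map x [0..<k]))"
  have eq: "\<tau> (map x [0..<j]) = \<tau> (map x [0..<i]) @ \<tau> (map x [i..<j])"
    using map_upt_split[of 0 i j x] assms by (simp add: substitution_append[OF subst])
  then have "?l i \<le> ?l j" by simp
  then have "map (subst_action \<tau> x) [0..<?l j] =
      map (subst_action \<tau> x) [0..<?l i] @ map (subst_action \<tau> x) [?l i..<?l j]"
    using map_upt_split[of 0 "?l i" "?l j"] by simp
  then show ?thesis using eq action_prefix[of x i] action_prefix[of x j] by (metis same_append_eq)
qed

lemma action_eqI:
  assumes "\<And>N. \<exists>n\<ge>N. \<exists>k. \<tau> (map x [0..<n]) = map y [0..<k]"
  shows "subst_action \<tau> x = y"
proof
  fix i
  obtain n k where n: "n \<ge> Suc i" "\<tau> (map x [0..<n]) = map y [0..<k]" using assms by blast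
  have "length (\<tau> (map x [0..<n])) \<ge> n" using length_le_image[of "map x [0..<n]"] by simp
  then have i: "i < length (\<tau> (map x [0..<n]))" using n(1) by simp
  then have "\<tau> (map x [0..<n]) ! i = y i" using n(2) by simp
  moreover have "\<tau> (map x [0..<n]) ! i = subst_action \<tau> x i"
    using has_inf_concat_nth[OF has_inf_concat_action, of i x n] i by (simp add: concat_upto_action)
  ultimately show "subst_action \<tau> x i = y i" by simp
qed

lemma action_in_X:
  assumes "x \<in> X"
  shows "subst_action \<tau> x \<in> X"
proof (rule in_X_if_prefixes)
  fix N
  have "map x [0..<N] \<in> L" using assms unfolding subst_subshift_iff by blast
  then have "\<tau> (map x [0..<N]) \<in> L" using power_in_language[of _ 1] by simp
  moreover have "length (\<tau> (map x [0..<N])) \<ge> N" using length_le_image[of "map x [0..<N]"] by simp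
  ultimately show "\<exists>n\<ge>N. map (subst_action \<tau> x) [0..<n] \<in> L" using action_prefix[of x N] by metis
qed

lemma implementation_action: "implementation X (subst_action \<tau>) (\<lambda>x. \<tau> [x 0])"
  unfolding implementation_def continuous_map_discrete_iff
proof (intro conjI ballI)
  show "\<exists>n. \<forall>y\<in>X. (\<forall>i<n. y i = x i) \<longrightarrow> \<tau> [y 0] = \<tau> [x 0]" for x
    by (intro exI[of _ 1]) simp
  show "has_inf_concat (\<lambda>i. \<tau> [(shift ^^ i) x 0]) (subst_action \<tau> x)" for x
    using has_inf_concat_action[of x] by (simp add: funpow_shift)
qed

lemma dill_map_action: "dill_map X X (subst_action \<tau>)"
  by (rule implementation_dill_map[OF implementation_action subshift_X subshift_X action_in_X])

text \<open>On a target without periodic points, \<open>\<Phi> (shift x) = (shift ^^ k) (\<Phi> x)\<close> determines \<open>k\<close>, so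
  all implementations have the same word lengths.\<close>

lemma implementation_length:
  assumes "implementation X (subst_action \<tau>) \<phi>" "x \<in> X"
  shows "length (\<phi> x) = length (\<tau> [x 0])"
proof (rule ccontr)
  let ?y = "subst_action \<tau> x"
  assume ne: "length (\<phi> x) \<noteq> length (\<tau> [x 0])"
  define k l where "k = min (length (\<phi> x)) (length (\<tau> [x 0]))" "l = max (length (\<phi> x)) (length (\<tau> [x 0]))"
  have "(shift ^^ length (\<phi> x)) ?y = (shift ^^ length (\<tau> [x 0])) ?y"
    using implementation_shift[OF assms(1) subshift_X assms(2)]
      implementation_shift[OF implementation_action subshift_X assms(2)] by simp
  then have "(shift ^^ l) ?y = (shift ^^ k) ?y" by (simp add: k_l_def min_def max_def)
  moreover have "k < l" using ne by (simp add: k_l_def min_def max_def)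
  ultimately have "(shift ^^ (l - k)) ((shift ^^ k) ?y) = (shift ^^ k) ?y"
    by (simp add: funpow_shift_add)
  moreover have "(shift ^^ k) ?y \<in> X" by (rule subshift_funpow[OF subshift_X action_in_X[OF assms(2)]])
  ultimately show False
    using aperiodic \<open>k < l\<close> unfolding aperiodic_subst_def no_periodic_points_def periodic_point_def
    by (meson zero_less_diff)
qed

text \<open>Prefixes of one word are nested, and no letter is erased, so comparing the lengths of
  images decides which prefix is shorter. Cuts are known only as positions in images.\<close>

lemma prefix_by_image:
  assumes "v1 @ v2 = v1' @ v2'" "length ((\<tau> ^^ n) v1) \<le> length ((\<tau> ^^ n) v1')"
  shows "\<exists>c. v1' = v1 @ c"
proof (cases "length v1 \<le> length v1'")
  case True
  then show ?thesis using append_eq_append_le[OF assms(1)] by blast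
next
  case False
  then obtain c where c: "v1 = v1' @ c" using append_eq_append_le[OF assms(1)[symmetric]] by auto
  then have "length ((\<tau> ^^ n) v1) = length ((\<tau> ^^ n) v1') + length ((\<tau> ^^ n) c)"
    by (simp add: power_append)
  then have "(\<tau> ^^ n) c = []" using assms(2) by simp
  then show ?thesis using c by simp
qed

text \<open>By primitivity a word of the language occurs in the images under all large powers, in
  particular under multiples of \<open>Suc p\<close>.\<close>

lemma language_power: "language (\<tau> ^^ Suc p) = L"
proof (intro equalityI subsetI)
  fix w assume "w \<in> language (\<tau> ^^ Suc p)"
  then show "w \<in> L" unfolding language_def funpow_mult by blast
next
  fix w assume "w \<in> L"
  then obtain N where "\<forall>n\<ge>N. \<forall>b. sublist w ((\<tau> ^^ n) [b])" using language_occurs by blast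
  then have "sublist w ((\<tau> ^^ (Suc p * N)) [undefined])" by simp
  then show "w \<in> language (\<tau> ^^ Suc p)" unfolding language_def funpow_mult by blast
qed

lemma aperiodic_primitive_power: "aperiodic_primitive (\<tau> ^^ Suc p)"
proof
  have X: "subst_subshift (\<tau> ^^ Suc p) = X"
    using language_power[of p] subst_subshift_iff[of _ "\<tau> ^^ Suc p"] subst_subshift_iff[of _ \<tau>] by blast
  show "substitution (\<tau> ^^ Suc p)" by (rule power)
  show "primitive_subst (\<tau> ^^ Suc p)"
  proof -
    obtain N where N: "\<And>n a b. n \<ge> N \<Longrightarrow> sublist [a] ((\<tau> ^^ n) [b])" using letters_occur by blast
    have "sublist [a] (((\<tau> ^^ Suc p) ^^ n) [b])" if "n \<ge> N" for n a b
      unfolding funpow_mult by (rule N) (use that in simp)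
    then show ?thesis unfolding primitive_subst_def eventually_sequentially by blast
  qed
  show "aperiodic_subst (\<tau> ^^ Suc p)" using aperiodic unfolding aperiodic_subst_def X .
  show "subst_subshift (\<tau> ^^ Suc p) \<noteq> {}" using nonempty unfolding X .
qed

end

text \<open>The data of the inverse: an exponent at which the kernels have stabilized, a
  synchronizing pair for the next power, and a gap bound for its occurrences. \<open>sync\<close>
  can speak of the language of \<open>\<tau>\<close> because the power has the same one.\<close>

locale desubstitution = aperiodic_primitive +
  fixes p :: nat and w1 w2 :: "'a list" and B :: nat
  assumes kernel: "(\<tau> ^^ Suc p) u = (\<tau> ^^ Suc p) v \<Longrightarrow> (\<tau> ^^ p) u = (\<tau> ^^ p) v"
    and sync: "v \<in> L \<Longrightarrow> (\<tau> ^^ Suc p) v = s @ w1 @ w2 @ t \<Longrightarrow>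
      \<exists>v1 v2. v = v1 @ v2 \<and> (\<tau> ^^ Suc p) v1 = s @ w1"
    and recurrent: "x \<in> X \<Longrightarrow> \<exists>j. i \<le> j \<and> j < i + B \<and> map x [j..<j + length (w1 @ w2)] = w1 @ w2"

lemma (in aperiodic_primitive) desubstitution_exists: "\<exists>p w1 w2 B. desubstitution \<tau> p w1 w2 B"
proof -
  obtain p where p: "\<forall>u v. (\<tau> ^^ Suc p) u = (\<tau> ^^ Suc p) v \<longrightarrow> (\<tau> ^^ p) u = (\<tau> ^^ p) v"
    using kernel_stabilizes[OF subst] by blast
  obtain w1 w2 where w: "aperiodic_primitive.synchronizing (\<tau> ^^ Suc p) w1 w2"
    using aperiodic_primitive.synchronizing_word[OF aperiodic_primitive_power] by blast
  note w = w[unfolded aperiodic_primitive.synchronizing_def[OF aperiodic_primitive_power] language_power]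
  obtain B where B: "\<forall>x\<in>X. \<forall>i. \<exists>j. i \<le> j \<and> j < i + B \<and>
      map x [j..<j + length (w1 @ w2)] = w1 @ w2"
    using occurs_boundedly w by blast
  have "desubstitution \<tau> p w1 w2 B"
  proof (intro desubstitution.intro aperiodic_primitive_axioms desubstitution_axioms.intro)
    show "(\<tau> ^^ p) u = (\<tau> ^^ p) v" if "(\<tau> ^^ Suc p) u = (\<tau> ^^ Suc p) v" for u v
      using p that by blast
    show "\<exists>v1 v2. v = v1 @ v2 \<and> (\<tau> ^^ Suc p) v1 = s @ w1"
      if "v \<in> L" "(\<tau> ^^ Suc p) v = s @ w1 @ w2 @ t" for v s t
      using w that by blast
    show "\<exists>j. i \<le> j \<and> j < i + B \<and> map x [j..<j + length (w1 @ w2)] = w1 @ w2" if "x \<in> X" for x i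
      using B that by blast
  qed
  then show ?thesis by blast
qed

section \<open>Cutting points and the construction of the inverse\<close>

context desubstitution
begin

abbreviation T :: "'a list \<Rightarrow> 'a list" where "T \<equiv> \<tau> ^^ Suc p"

lemma T_eq: "T v = \<tau> ((\<tau> ^^ p) v)" by simp

definition occurs :: "(nat \<Rightarrow> 'a) \<Rightarrow> nat \<Rightarrow> bool" where
  "occurs y i \<longleftrightarrow> map y [i..<i + length (w1 @ w2)] = w1 @ w2"

definition next_occ :: "(nat \<Rightarrow> 'a) \<Rightarrow> nat \<Rightarrow> nat" where
  "next_occ y n = (LEAST i. n \<le> i \<and> occurs y i)"

definition cut :: "(nat \<Rightarrow> 'a) \<Rightarrow> nat \<Rightarrow> nat" where
  "cut y n = next_occ y n + length w1"

text \<open>The chosen preimage \<open>v\<close> is not unique, but \<open>(\<tau> ^^ p) v\<close>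
  is, by \<open>kernel\<close>. Outside the range of \<open>T\<close> the value is
  arbitrary.\<close>

definition decode :: "'a list \<Rightarrow> 'a list" where
  "decode W = (\<tau> ^^ p) (SOME v. T v = W)"

text \<open>Output is produced only when an occurrence starts at 0, and then for the whole segment
  up to the next cut. The argument 1 in \<open>cut y 1\<close> makes the search for that cut skip
  the present occurrence.\<close>

definition block :: "(nat \<Rightarrow> 'a) \<Rightarrow> 'a list" where
  "block y = (if occurs y 0 then decode (map y [length w1..<cut y 1]) else [])"

definition desubst :: "(nat \<Rightarrow> 'a) \<Rightarrow> (nat \<Rightarrow> 'a)" where
  "desubst y = inf_concat (\<lambda>i. block ((shift ^^ i) y))"

lemma decode_T: "decode (T v) = (\<tau> ^^ p) v"
  unfolding decode_def by (rule kernel) (rule someI, rule refl)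

lemma occurs_shift: "occurs ((shift ^^ n) y) i \<longleftrightarrow> occurs y (n + i)"
  unfolding occurs_def map_upt_shift by (simp add: add.assoc)

lemma next_occ:
  assumes "y \<in> X"
  shows "occurs y (next_occ y n)" "n \<le> next_occ y n" "next_occ y n < n + B"
proof -
  obtain j where j: "n \<le> j \<and> occurs y j" "j < n + B"
    using recurrent[OF assms, of n] unfolding occurs_def by blast
  have "n \<le> next_occ y n \<and> occurs y (next_occ y n)"
    unfolding next_occ_def by (rule LeastI[of "\<lambda>i. n \<le> i \<and> occurs y i", OF j(1)])
  then show "occurs y (next_occ y n)" "n \<le> next_occ y n" by auto
  have "next_occ y n \<le> j" 
    unfolding next_occ_def by (rule Least_le[of "\<lambda>i. n \<le> i \<and> occurs y i", OF j(1)])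
  then show "next_occ y n < n + B" using j(2) by simp
qed

lemma not_occurs_before: "n \<le> i \<Longrightarrow> i < next_occ y n \<Longrightarrow> \<not> occurs y i"
  unfolding next_occ_def using not_less_Least by blast

lemma next_occ_eqI:
  assumes "n \<le> i" "occurs y i" "\<And>j. n \<le> j \<Longrightarrow> j < i \<Longrightarrow> \<not> occurs y j"
  shows "next_occ y n = i"
  unfolding next_occ_def by (rule Least_equality) (use assms in \<open>auto simp: not_less[symmetric]\<close>)

lemma next_occ_shift:
  assumes "y \<in> X"
  shows "n + next_occ ((shift ^^ n) y) m = next_occ y (n + m)"
proof -
  have "next_occ ((shift ^^ n) y) m = next_occ y (n + m) - n"
  proof (rule next_occ_eqI)
    show "m \<le> next_occ y (n + m) - n" using next_occ(2)[OF assms, of "n + m"] by simp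
    show "occurs ((shift ^^ n) y) (next_occ y (n + m) - n)"
      using next_occ(1,2)[OF assms, of "n + m"] by (simp add: occurs_shift)
    show "\<not> occurs ((shift ^^ n) y) j" if "m \<le> j" "j < next_occ y (n + m) - n" for j
      unfolding occurs_shift by (rule not_occurs_before[of "n + m"]) (use that in auto)
  qed
  then show ?thesis using next_occ(2)[OF assms, of "n + m"] by simp
qed

lemma next_occ_Suc:
  assumes "y \<in> X"
  shows "occurs y n \<Longrightarrow> next_occ y n = n" "\<not> occurs y n \<Longrightarrow> next_occ y (Suc n) = next_occ y n"
proof -
  show "occurs y n \<Longrightarrow> next_occ y n = n" by (rule next_occ_eqI) auto
  assume n: "\<not> occurs y n"
  show "next_occ y (Suc n) = next_occ y n"
  proof (rule next_occ_eqI)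
    show "occurs y (next_occ y n)" by (rule next_occ(1)[OF assms])
    then show "Suc n \<le> next_occ y n" using n next_occ(2)[OF assms, of n] by (metis Suc_leI le_neq_implies_less)
    show "\<not> occurs y j" if "Suc n \<le> j" "j < next_occ y n" for j
      by (rule not_occurs_before[of n]) (use that in auto)
  qed
qed

lemma next_occ_mono:
  assumes "y \<in> X" "m \<le> n"
  shows "next_occ y m \<le> next_occ y n"
  unfolding next_occ_def[of y m] by (rule Least_le) (use next_occ(1,2)[OF assms(1), of n] assms(2) in auto)

lemma sync_cut:
  assumes "v \<in> L" "T v = a @ map y [0..<N] @ b" "occurs y i" "i + length (w1 @ w2) \<le> N"
  shows "\<exists>v1 v2. v = v1 @ v2 \<and> T v1 = a @ map y [0..<i + length w1]"
proof -
  have *: "map y [i..<i + length w1] @ map y [i + length w1..<i + length (w1 @ w2)] = w1 @ w2"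
    using assms(3) map_upt_split[of i "i + length w1" "i + length (w1 @ w2)" y] by (simp add: occurs_def)
  then have w1: "map y [i..<i + length w1] = w1" by (subst (asm) append_eq_append_conv) auto
  have "map y [0..<N] = map y [0..<i] @ map y [i..<i + length (w1 @ w2)] @ map y [i + length (w1 @ w2)..<N]"
    using map_upt_split[of 0 i N y] map_upt_split[of i "i + length (w1 @ w2)" N y] assms(4) by simp
  also have "map y [i..<i + length (w1 @ w2)] = w1 @ w2" using assms(3) by (simp only: occurs_def)
  finally have "T v = (a @ map y [0..<i]) @ w1 @ w2 @ (map y [i + length (w1 @ w2)..<N] @ b)"
    using assms(2) by (simp only: append.assoc)
  from sync[OF assms(1) this] obtain v1 v2 where v: "v = v1 @ v2" "T v1 = (a @ map y [0..<i]) @ w1"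
    by blast
  have "map y [0..<i + length w1] = map y [0..<i] @ w1"
    using map_upt_split[of 0 i "i + length w1" y] w1 by simp
  then show ?thesis using v by (metis append.assoc)
qed

text \<open>Put a prefix of \<open>y\<close> containing both occurrences into some
  \<open>T v\<close>. Both cuts then fall between letters of \<open>v\<close>, and the letters
  between them form the required word.\<close>

lemma segment_desubstitute:
  assumes "y \<in> X" "occurs y i" "occurs y j" "i \<le> j"
  shows "\<exists>v\<in>L. map y [i + length w1..<j + length w1] = T v"
proof -
  let ?N = "j + length (w1 @ w2)"
  have "map y [0..<?N] \<in> L" using assms(1) unfolding subst_subshift_iff by blast
  then obtain v where "v \<in> L" "sublist (map y [0..<?N]) (T v)" using language_desubstitute by blast
  then obtain a b where v: "v \<in> L" "T v = a @ map y [0..<?N] @ b" by (auto simp: sublist_def simp del: funpow.simps)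
  obtain v1 v2 where v1: "v = v1 @ v2" "T v1 = a @ map y [0..<i + length w1]"
    using sync_cut[OF v assms(2)] assms(4) by auto
  obtain v1' v2' where v1': "v = v1' @ v2'" "T v1' = a @ map y [0..<j + length w1]"
    using sync_cut[OF v assms(3)] by auto
  have "length (T v1) \<le> length (T v1')" unfolding v1(2) v1'(2) using assms(4) by simp
  then obtain c where c: "v1' = v1 @ c"
    using prefix_by_image[of v1 v2 v1' v2' "Suc p"] v1(1) v1'(1) by blast
  have "T v1' = T v1 @ T c" unfolding c by (rule power_append)
  then have "map y [0..<j + length w1] = map y [0..<i + length w1] @ T c"
    unfolding v1(2) v1'(2) by simp
  then have "map y [i + length w1..<j + length w1] = T c"
    using map_upt_split[of 0 "i + length w1" "j + length w1" y] assms(4) by simp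
  moreover have "c \<in> L" by (rule language_sublist[OF v(1)]) (simp add: v1'(1) c)
  ultimately show ?thesis by blast
qed

definition decoded :: "(nat \<Rightarrow> 'a) \<Rightarrow> nat \<Rightarrow> 'a list" where
  "decoded y n = decode (map y [cut y 0..<cut y n])"

lemma decoded:
  assumes "y \<in> X"
  shows "decoded y n \<in> L" "\<tau> (decoded y n) = map y [cut y 0..<cut y n]"
proof -
  obtain v where v: "v \<in> L" "map y [cut y 0..<cut y n] = T v"
    using segment_desubstitute[OF assms next_occ(1)[OF assms] next_occ(1)[OF assms] next_occ_mono[OF assms]]
    unfolding cut_def by blast
  show "decoded y n \<in> L" "\<tau> (decoded y n) = map y [cut y 0..<cut y n]"
    unfolding decoded_def v(2) decode_T using power_in_language[OF v(1)] by auto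
qed

text \<open>Decoding cut by cut agrees with decoding from the first cut in one go, because
  \<open>decode\<close> is multiplicative on images under \<open>T\<close>. At positions without an
  occurrence neither side changes.\<close>

lemma concat_blocks:
  assumes "y \<in> X"
  shows "concat_upto (\<lambda>i. block ((shift ^^ i) y)) n = decoded y n"
proof (induction n)
  case 0
  have "decode [] = []" using decode_T[of "[]"] unfolding power_Nil .
  then show ?case by (simp add: concat_upto_def decoded_def)
next
  case (Suc n)
  have "decoded y (Suc n) = decoded y n @ block ((shift ^^ n) y)"
  proof (cases "occurs y n")
    case True
    have cn: "cut y n = n + length w1" unfolding cut_def using next_occ_Suc(1)[OF assms True] by simp
    have "n + cut ((shift ^^ n) y) 1 = cut y (Suc n)"
      unfolding cut_def using next_occ_shift[OF assms, of n 1] by simp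
    then have "block ((shift ^^ n) y) = decode (map y [cut y n..<cut y (Suc n)])"
      using True by (simp add: block_def occurs_shift map_upt_shift cn)
    moreover obtain v where v: "map y [cut y 0..<cut y n] = T v"
      using segment_desubstitute[OF assms next_occ(1)[OF assms] next_occ(1)[OF assms] next_occ_mono[OF assms]]
      unfolding cut_def by blast
    moreover obtain v' where v': "map y [cut y n..<cut y (Suc n)] = T v'"
      using segment_desubstitute[OF assms next_occ(1)[OF assms] next_occ(1)[OF assms] next_occ_mono[OF assms]]
      unfolding cut_def by (metis le_SucI order_refl)
    moreover have "map y [cut y 0..<cut y (Suc n)] = T (v @ v')"
      using v v' map_upt_split[of "cut y 0" "cut y n" "cut y (Suc n)" y] next_occ_mono[OF assms]
      unfolding power_append by (simp add: cut_def del: funpow.simps)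
    ultimately show ?thesis unfolding decoded_def using decode_T[of v] decode_T[of v'] decode_T[of "v @ v'"]
      by (metis power_append)
  next
    case False
    then show ?thesis
      using next_occ_Suc(2)[OF assms False] by (simp add: decoded_def cut_def block_def occurs_shift)
  qed
  then show ?case using Suc by (simp add: concat_upto_Suc)
qed

lemma cut_bounds:
  assumes "y \<in> X"
  shows "n + length w1 \<le> cut y n" "cut y n \<le> n + B + length w1"
  using next_occ(2,3)[OF assms, of n] by (auto simp: cut_def)

text \<open>Both ends of the restored segment are delayed by \<open>length w1\<close> plus at most
  \<open>B\<close>; the common part cancels.\<close>

lemma length_decoded:
  assumes "y \<in> X"
  shows "length (\<tau> (decoded y n)) \<le> n + B" "n \<le> length (\<tau> (decoded y n)) + B"
  unfolding decoded(2)[OF assms] using cut_bounds[OF assms, of n] cut_bounds[OF assms, of 0] by auto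

lemma decoded_unbounded:
  assumes "y \<in> X"
  shows "\<exists>n. N \<le> length (decoded y n)"
proof -
  \<comment> \<open>At most \<open>B\<close> letters are lost at the ends, and \<open>\<tau>\<close>
    lengthens words by a factor of at most \<open>max_len 1\<close>.\<close>
  let ?n = "max_len 1 * N + B"
  have "max_len 1 * N \<le> length (\<tau> (decoded y ?n))" using length_decoded(2)[OF assms, of ?n] by simp
  also have "\<dots> \<le> max_len 1 * length (decoded y ?n)" using power_le_max_len[of 1] by simp
  finally show ?thesis using max_len_pos[of 1] by (intro exI[of _ ?n]) simp
qed

lemma has_inf_concat_desubst:
  assumes "y \<in> X"
  shows "has_inf_concat (\<lambda>i. block ((shift ^^ i) y)) (desubst y)"
  unfolding desubst_def
  by (rule has_inf_concat_inf_concat, rule concat_filterlim)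
    (use decoded_unbounded[OF assms] in \<open>simp add: concat_blocks[OF assms]\<close>)

lemma decoded_prefix:
  assumes "y \<in> X"
  shows "decoded y n = map (desubst y) [0..<length (decoded y n)]"
  using has_inf_concat_desubst[OF assms] unfolding has_inf_concat_def concat_blocks[OF assms] by blast

lemma desubst_in_X:
  assumes "y \<in> X"
  shows "desubst y \<in> X"
proof (rule in_X_if_prefixes)
  fix N
  obtain n where "N \<le> length (decoded y n)" using decoded_unbounded[OF assms] by blast
  then show "\<exists>n\<ge>N. map (desubst y) [0..<n] \<in> L"
    using decoded(1)[OF assms, of n] decoded_prefix[OF assms, of n] by metis
qed

lemma implementation_desubst: "implementation X desubst block"
  unfolding implementation_def continuous_map_discrete_iff
proof (intro conjI ballI has_inf_concat_desubst)
  fix x assume x: "x \<in> X"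
  let ?k = "next_occ x 1"
  \<comment> \<open>The window reaches to the end of the first occurrence after position 0, so
    agreement on it preserves whether 0 is an occurrence, where the next cut is, and the word to be
    decoded.\<close>
  let ?n = "?k + length (w1 @ w2)"
  have "block y = block x" if y: "y \<in> X" "\<forall>i<?n. y i = x i" for y
  proof -
    have occ: "occurs y i \<longleftrightarrow> occurs x i" if "i \<le> ?k" for i
    proof -
      have "map y [i..<i + length (w1 @ w2)] = map x [i..<i + length (w1 @ w2)]"
        using y(2) that by auto
      then show ?thesis by (simp only: occurs_def)
    qed
    have nxt: "next_occ y 1 = ?k"
    proof (rule next_occ_eqI)
      show "1 \<le> ?k" by (rule next_occ(2)[OF x])
      show "occurs y ?k" using next_occ(1)[OF x] occ by simp
      show "\<not> occurs y j" if "1 \<le> j" "j < ?k" for j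
        using not_occurs_before[OF that] occ that by simp
    qed
    have "map y [length w1..<?k + length w1] = map x [length w1..<?k + length w1]"
      using y(2) by auto
    then show ?thesis unfolding block_def cut_def nxt occ[of 0, OF le0] by (rule arg_cong)
  qed
  then show "\<exists>n. \<forall>y\<in>X. (\<forall>i<n. y i = x i) \<longrightarrow> block y = block x" by blast
qed

lemma dill_map_desubst: "dill_map X X desubst"
  by (rule implementation_dill_map[OF implementation_desubst subshift_X subshift_X desubst_in_X])

section \<open>Both compositions with \<open>\<tau>\<close> are shifts\<close>

lemma action_desubst:
  assumes "y \<in> X"
  shows "subst_action \<tau> (desubst y) = (shift ^^ cut y 0) y"
proof (rule action_eqI)
  fix N
  obtain n where n: "N \<le> length (decoded y n)" using decoded_unbounded[OF assms] by blast
  let ?l = "length (decoded y n)"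
  \<comment> \<open>\<open>\<tau>\<close> turns the decoded \<open>(\<tau> ^^ p) v\<close> back into
    \<open>T v\<close>, so only the part of \<open>y\<close> before its first cut is
    missing.\<close>
  have "\<tau> (map (desubst y) [0..<?l]) = map y [cut y 0..<cut y n]"
    using decoded(2)[OF assms, of n] decoded_prefix[OF assms, of n] by metis
  also have "\<dots> = map ((shift ^^ cut y 0) y) [0..<cut y n - cut y 0]"
    using next_occ_mono[OF assms, of 0 n] by (simp add: map_upt_shift cut_def add.commute)
  finally show "\<exists>n\<ge>N. \<exists>k. \<tau> (map (desubst y) [0..<n]) = map ((shift ^^ cut y 0) y) [0..<k]"
    using n by blast
qed

text \<open>Synchronization yields cuts in a word \<open>v\<close> two levels apart from
  \<open>\<tau> x\<close>, but they are needed in \<open>x\<close>. A prefix of \<open>x\<close>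
  lies in some \<open>(\<tau> ^^ p) v\<close>, so its image lies in \<open>T v\<close>; pushing the
  cuts of \<open>v\<close> forward by \<open>\<tau> ^^ p\<close> gives positions in
  \<open>x\<close>, with a word \<open>(\<tau> ^^ p) e\<close> between them.\<close>

lemma action_cut:
  assumes x: "x \<in> X" and occ: "occurs (subst_action \<tau> x) i" "occurs (subst_action \<tau> x) i'" and "i \<le> i'"
  shows "\<exists>j j' v. j \<le> j' \<and> i + length w1 = length (\<tau> (map x [0..<j])) \<and>
    i' + length w1 = length (\<tau> (map x [0..<j'])) \<and> map x [j..<j'] = (\<tau> ^^ p) v"
proof -
  \<comment> \<open>Since \<open>\<tau>\<close> does not shorten words, the image of this prefix
    contains the whole occurrence at \<open>i'\<close>.\<close>
  let ?y = "subst_action \<tau> x" and ?n = "i' + length (w1 @ w2)"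
  let ?u = "map x [0..<?n]"
  define N where "N = length (\<tau> ?u)"
  have N: "?n \<le> N" using length_le_image[of ?u] by (simp add: N_def)
  have "?u \<in> L" using x unfolding subst_subshift_iff by blast
  then obtain v where "v \<in> L" "sublist ?u ((\<tau> ^^ p) v)" using language_desubstitute by blast
  then obtain a b where v: "v \<in> L" "(\<tau> ^^ p) v = a @ ?u @ b" by (auto simp: sublist_def)
  have "T v = \<tau> a @ \<tau> ?u @ \<tau> b" unfolding T_eq v(2) by (simp only: substitution_append[OF subst])
  also have "\<tau> ?u = map ?y [0..<N]" unfolding N_def by (rule action_prefix)
  finally have Tv: "T v = \<tau> a @ map ?y [0..<N] @ \<tau> b" .
  \<comment> \<open>A cut of \<open>v\<close> is transported into the prefix \<open>?u\<close> of
    \<open>x\<close>: on each side the lengths are compared after applying \<open>\<tau>\<close>,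
    where the positions are known.\<close>
  have locate: "\<exists>c d. (\<tau> ^^ p) v1 = a @ c \<and> ?u = c @ d \<and> \<tau> c = map ?y [0..<k + length w1]"
    if v1: "v = v1 @ v2" "T v1 = \<tau> a @ map ?y [0..<k + length w1]" and k: "k \<le> i'" for v1 v2 k
  proof -
    have eq: "a @ (?u @ b) = (\<tau> ^^ p) v1 @ (\<tau> ^^ p) v2" using v(2) v1(1) by (simp add: power_append)
    have "length (\<tau> a) \<le> length (\<tau> ((\<tau> ^^ p) v1))" using v1(2) unfolding T_eq by simp
    then obtain c where c: "(\<tau> ^^ p) v1 = a @ c" using prefix_by_image[OF eq, of 1] by auto
    then have \<tau>c: "\<tau> c = map ?y [0..<k + length w1]"
      using v1(2) unfolding T_eq by (simp add: substitution_append[OF subst])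
    have eq': "c @ (\<tau> ^^ p) v2 = ?u @ b" using eq c by simp
    have "length (\<tau> c) \<le> length (\<tau> ?u)" unfolding \<tau>c using N k by (simp add: N_def)
    then obtain d where "?u = c @ d" using prefix_by_image[OF eq', of 1] by auto
    then show ?thesis using c \<tau>c by blast
  qed
  have "i + length (w1 @ w2) \<le> N" using N assms(4) by simp
  then obtain v1 v2 where v1: "v = v1 @ v2" "T v1 = \<tau> a @ map ?y [0..<i + length w1]"
    using sync_cut[OF v(1) Tv occ(1)] by blast
  obtain v1' v2' where v1': "v = v1' @ v2'" "T v1' = \<tau> a @ map ?y [0..<i' + length w1]"
    using sync_cut[OF v(1) Tv occ(2) N] by blast
  obtain c d where c: "(\<tau> ^^ p) v1 = a @ c" "?u = c @ d" "\<tau> c = map ?y [0..<i + length w1]"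
    using locate[OF v1 assms(4)] by blast
  obtain c' d' where c': "(\<tau> ^^ p) v1' = a @ c'" "?u = c' @ d'" "\<tau> c' = map ?y [0..<i' + length w1]"
    using locate[OF v1' order_refl] by blast
  have "length (T v1) \<le> length (T v1')" unfolding v1(2) v1'(2) using assms(4) by simp
  then obtain e where e: "v1' = v1 @ e"
    using prefix_by_image[of v1 v2 v1' v2' "Suc p"] v1(1) v1'(1) by blast
  have cc': "c' = c @ (\<tau> ^^ p) e" using c(1) c'(1) by (simp add: e power_append)
  have pre: "s = map x [0..<length s]" if "?u = s @ t" for s t
  proof -
    have "s = take (length s) ?u" using that by simp
    moreover have "length s \<le> ?n" using arg_cong[OF that, of length] by simp
    ultimately show ?thesis by (simp add: take_map)
  qed
  let ?j = "length c" and ?j' = "length c'"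
  have "map x [0..<?j'] = map x [0..<?j] @ map x [?j..<?j']"
    using map_upt_split[of 0 ?j ?j' x] cc' by simp
  then have "map x [?j..<?j'] = (\<tau> ^^ p) e" using pre[OF c(2)] pre[OF c'(2)] cc' by (metis same_append_eq)
  moreover have "i + length w1 = length (\<tau> (map x [0..<?j]))"
    using c(3) pre[OF c(2)] by (metis diff_zero length_map length_upt)
  moreover have "i' + length w1 = length (\<tau> (map x [0..<?j']))"
    using c'(3) pre[OF c'(2)] by (metis diff_zero length_map length_upt)
  ultimately show ?thesis using cc' by (intro exI[of _ ?j] exI[of _ ?j'] exI[of _ e]) simp
qed

lemma length_image_inj:
  assumes "length (\<tau> (map x [0..<j])) = length (\<tau> (map x [0..<k]))"
  shows "j = k"
proof -
  have "length (\<tau> (map x [0..<j])) < length (\<tau> (map x [0..<k]))" if "j < k" for j k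
  proof -
    have "map x [0..<k] = map x [0..<j] @ map x [j..<k]" using map_upt_split[of 0 j k x] that by simp
    then have "length (\<tau> (map x [0..<k])) = length (\<tau> (map x [0..<j])) + length (\<tau> (map x [j..<k]))"
      by (simp add: substitution_append[OF subst])
    then show ?thesis
      using length_le_image[of "map x [j..<k]"] that unfolding length_map length_upt by linarith
  qed
  then show ?thesis using assms by (metis less_irrefl nat_neq_iff)
qed

text \<open>Between cuts \<open>\<tau> x\<close> reads \<open>T v\<close> where \<open>x\<close>
  reads \<open>(\<tau> ^^ p) v\<close>, which is exactly what \<open>decode\<close> returns. So
  \<open>x\<close> is recovered from the position of the first cut on.\<close>

lemma desubst_action:
  assumes x: "x \<in> X"
  shows "\<exists>j. desubst (subst_action \<tau> x) = (shift ^^ j) x"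
proof -
  let ?y = "subst_action \<tau> x"
  have y: "?y \<in> X" by (rule action_in_X[OF x])
  have seg: "\<exists>j j' v. j \<le> j' \<and> cut ?y 0 = length (\<tau> (map x [0..<j])) \<and>
      cut ?y n = length (\<tau> (map x [0..<j'])) \<and> map x [j..<j'] = (\<tau> ^^ p) v" for n
    unfolding cut_def
    by (rule action_cut[OF x next_occ(1)[OF y] next_occ(1)[OF y] next_occ_mono[OF y]]) simp
  obtain j where j: "cut ?y 0 = length (\<tau> (map x [0..<j]))" using seg[of 0] by blast
  have "decoded ?y n = map ((shift ^^ j) x) [0..<length (decoded ?y n)]" for n
  proof -
    obtain i j' v where *: "i \<le> j'" "cut ?y 0 = length (\<tau> (map x [0..<i]))"
      "cut ?y n = length (\<tau> (map x [0..<j']))" "map x [i..<j'] = (\<tau> ^^ p) v" using seg by blast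
    \<comment> \<open>\<open>action_cut\<close> picks a starting index for each \<open>n\<close>
      separately; all pull back the same first cut, hence agree.\<close>
    have i: "i = j" using length_image_inj *(2) j by metis
    have "map ?y [cut ?y 0..<cut ?y n] = \<tau> (map x [i..<j'])"
      using action_segment[OF *(1), of x] *(2,3) by simp
    also have "\<dots> = T v" unfolding *(4) T_eq ..
    finally have "decoded ?y n = map x [j..<j']" unfolding decoded_def using decode_T *(4) i by simp
    then show ?thesis using *(1) i by (simp add: map_upt_shift)
  qed
  then have "has_inf_concat (\<lambda>i. block ((shift ^^ i) ?y)) ((shift ^^ j) x)"
    using has_inf_concat_desubst[OF y] unfolding has_inf_concat_def concat_blocks[OF y] by blast
  then show ?thesis using has_inf_concat_unique[OF has_inf_concat_desubst[OF y]] by blast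
qed

lemma almost_inverse_desubst: "almost_inverse X X (subst_action \<tau>) desubst"
  unfolding almost_inverse_def almost_equivalent_def
proof (intro conjI dill_map_action dill_map_desubst dill_map_comp[OF dill_map_action dill_map_desubst]
    dill_map_comp[OF dill_map_desubst dill_map_action] dill_map_id[OF subshift_X] minimal_X ballI)
  fix x assume x: "x \<in> X"
  obtain j where "desubst (subst_action \<tau> x) = (shift ^^ j) x" using desubst_action[OF x] by blast
  then show "\<exists>i j. (shift ^^ i) ((desubst \<circ> subst_action \<tau>) x) = (shift ^^ j) (id x)"
    by (intro exI[of _ 0] exI[of _ j]) simp
  show "\<exists>i j. (shift ^^ i) ((subst_action \<tau> \<circ> desubst) x) = (shift ^^ j) (id x)"
    using action_desubst[OF x] by (intro exI[of _ 0] exI[of _ "cut x 0"]) simp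
qed

text \<open>Let \<open>l\<close> be the length of the output after \<open>n\<close> steps. Its image
  under \<open>\<tau>\<close> has length \<open>Z * l\<close> up to \<open>D\<close> and length
  \<open>n\<close> up to \<open>B\<close>, so \<open>l\<close> is \<open>n / Z\<close> up to
  \<open>(D + B) / Z\<close>.\<close>

lemma balanced_growth_desubst:
  assumes "balanced_growth X X (subst_action \<tau>)"
  shows "balanced_growth X X desubst"
proof -
  obtain \<phi> Z D where \<phi>: "implementation X (subst_action \<tau>) \<phi>"
    and ZD: "\<forall>x\<in>X. \<forall>n. real (length (iter_word \<phi> n x)) \<in> {Z * real n - real D..Z * real n + real D}"
    using assms unfolding balanced_growth_def by blast
  have iter: "length (iter_word \<phi> n x) = length (\<tau> (map x [0..<n]))" if x: "x \<in> X" for n x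
  proof -
    have "map (\<lambda>i. length (\<phi> ((shift ^^ i) x))) [0..<n] = map (\<lambda>i. length (\<tau> [x i])) [0..<n]"
      using implementation_length[OF \<phi> subshift_funpow[OF subshift_X x]] by (simp add: funpow_shift)
    then have "length (iter_word \<phi> n x) = length (concat_upto (\<lambda>i. \<tau> [x i]) n)"
      unfolding iter_word_def concat_upto_def length_concat map_map o_def by (rule arg_cong)
    then show ?thesis by (simp only: concat_upto_action)
  qed
  have bound: "\<bar>real (length (\<tau> (map x [0..<n]))) - Z * real n\<bar> \<le> real D" if "x \<in> X" for x n
    using bspec[OF ZD that, rule_format, of n] iter[OF that, of n] by (simp add: abs_le_iff)
  \<comment> \<open>At \<open>Suc D\<close> letters the image has length at least
    \<open>Suc D\<close>, whereas \<open>Z \<le> 0\<close> would allow at most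
    \<open>D\<close>.\<close>
  have Z: "Z > 0"
  proof (rule ccontr)
    assume "\<not> Z > 0"
    then have "Z * real (Suc D) \<le> 0" by (simp add: mult_le_0_iff)
    moreover obtain x where x: "x \<in> X" using nonempty by blast
    moreover have "real (Suc D) \<le> real (length (\<tau> (map x [0..<Suc D])))"
      using length_le_image[of "map x [0..<Suc D]"] by (simp del: upt_Suc)
    ultimately show False using bound[OF x, of "Suc D"] by linarith
  qed
  define D' where "D' = nat \<lceil>real (D + B) / Z\<rceil>"
  have D': "\<bar>real (length (iter_word block n y)) - 1 / Z * real n\<bar> \<le> real D'" if y: "y \<in> X" for n y
  proof -
    define l where "l = length (decoded y n)"
    have l: "length (iter_word block n y) = l" unfolding iter_word_def concat_blocks[OF y] l_def ..
    have "\<bar>real (length (\<tau> (decoded y n))) - Z * real l\<bar> \<le> real D"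
      using bound[OF desubst_in_X[OF y], of l] decoded_prefix[OF y, of n] unfolding l_def by metis
    moreover have "\<bar>real (length (\<tau> (decoded y n))) - real n\<bar> \<le> real B"
      using length_decoded[OF y, of n] by linarith
    ultimately have "\<bar>Z * real l - real n\<bar> \<le> real (D + B)" by simp
    then have "\<bar>Z * real l - real n\<bar> / Z \<le> real (D + B) / Z" using Z by (intro divide_right_mono) auto
    moreover have "Z * real l - real n = Z * (real l - 1 / Z * real n)"
      using Z by (simp add: right_diff_distrib)
    then have "\<bar>Z * real l - real n\<bar> / Z = \<bar>real l - 1 / Z * real n\<bar>"
      using Z by (simp add: abs_mult)
    moreover have "real (D + B) / Z \<le> real D'" unfolding D'_def by (rule real_nat_ceiling_ge)
    ultimately show ?thesis unfolding l by linarith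
  qed
  have lim: "(\<lambda>n. real (length (iter_word block n y)) / real n) \<longlonglongrightarrow> 1 / Z" if y: "y \<in> X" for y
  proof (rule LIM_zero_cancel, rule Lim_null_comparison)
    show "(\<lambda>n. real D' / real n) \<longlonglongrightarrow> 0" by (rule lim_const_over_n)
    show "\<forall>\<^sub>F n in sequentially. norm (real (length (iter_word block n y)) / real n - 1 / Z) \<le> real D' / real n"
      using eventually_gt_at_top[of 0]
    proof eventually_elim
      case (elim n)
      have "real (length (iter_word block n y)) / real n - 1 / Z =
          (real (length (iter_word block n y)) - 1 / Z * real n) / real n"
        using elim by (simp add: diff_divide_distrib)
      then show ?case using divide_right_mono[OF D'[OF y, of n], of "real n"] by simp
    qed
  qed
  have "real (length (iter_word block n y)) \<in> {1 / Z * real n - real D'..1 / Z * real n + real D'}"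
    if "y \<in> X" for n y
    using D'[OF that, of n] by (simp add: abs_le_iff)
  then show ?thesis
    unfolding balanced_growth_def
    using dill_map_desubst aperiodic[unfolded aperiodic_subst_def] implementation_desubst lim by blast
qed

end

theorem lemma17:
  fixes \<tau> :: "'a::finite list \<Rightarrow> 'a list"
  assumes "substitution \<tau>"
    and "primitive_subst \<tau>"
    and "aperiodic_subst \<tau>"
  shows "almost_invertible (subst_subshift \<tau>) (subst_subshift \<tau>) (subst_action \<tau>) \<and>
    (balanced_growth (subst_subshift \<tau>) (subst_subshift \<tau>) (subst_action \<tau>) \<longrightarrow>
      (\<exists>\<Psi>. almost_inverse (subst_subshift \<tau>) (subst_subshift \<tau>) (subst_action \<tau>) \<Psi> \<and>
           balanced_growth (subst_subshift \<tau>) (subst_subshift \<tau>) \<Psi>))"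
proof (cases "subst_subshift \<tau> = {}")
  case True
  \<comment> \<open>The hypotheses allow this: the identity on a one-letter alphabet generates no infinite word.\<close>
  have sub: "subshift ({} :: (nat \<Rightarrow> 'a) set)" unfolding subshift_def by simp
  have "dill_map {} {} \<Phi>" for \<Phi> :: "(nat \<Rightarrow> 'a) \<Rightarrow> (nat \<Rightarrow> 'a)"
    unfolding dill_map_def continuous_map_full_shift_iff continuous_map_discrete_iff using sub by simp
  moreover have "minimal_subshift ({} :: (nat \<Rightarrow> 'a) set)" using sub by (simp add: minimal_subshift_def)
  ultimately have "almost_inverse {} {} (subst_action \<tau>) (subst_action \<tau>)"
    by (simp add: almost_inverse_def almost_equivalent_def)
  then show ?thesis unfolding True almost_invertible_def by blast
next
  case False
  then have "aperiodic_primitive \<tau>" using assms by (intro aperiodic_primitive.intro)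
  then obtain p w1 w2 B where "desubstitution \<tau> p w1 w2 B"
    using aperiodic_primitive.desubstitution_exists by blast
  then interpret desubstitution \<tau> p w1 w2 B .
  show ?thesis
    using almost_inverse_desubst balanced_growth_desubst unfolding almost_invertible_def by blast
qed

end
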